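(* For a pseudovariety $\mathsf{V}$ of semigroups, exactly one of the following alternatives holds: (1) $\mathsf{V}$ is F-saturated (whence F-epimorphically closed) and $\mathsf{V}$ is contained in one of the three pseudovarieties $\mathsf{V}_1,\mathsf{V}_2,\mathsf{V}_3$, where $\mathsf{V}_1$, $\mathsf{V}_2$, $\mathsf{V}_3$ consist of all finite semigroups $S$ such that, for all $x\in S$ and all idempotents $e,f\in S$, respectively $(exf)^{\omega+1}=exf$, $exf(ef)^\omega=exf$, $(ef)^\omega exf=exf$; (2) $\mathsf{V}$ is not F-saturated and no proper F-epimorphically closed pseudovariety contains $\mathsf{V}$ (proper meaning different from the pseudovariety $\mathsf{S}$ of all finite semigroups). To determine whether it is the second alternative that holds, it suffices to check whether $Y\in\mathsf{V}$ (that is, (2) holds if and only if $Y\in\mathsf{V}$). In particular, it is decidable whether a given pseudovariety with decidable membership problem is F-saturated. In case $\mathsf{V}$ is a proper subpseudovariety of $\mathsf{S}$, $\mathsf{V}$ is F-epimorphically closed if and only if it is F-saturated.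
   Context: A pseudovariety of semigroups is a class of finite semigroups closed under taking homomorphic images, subsemigroups, and finite direct products. For an element $s$ of a finite semigroup, $s^\omega$ denotes its unique idempotent power and $s^{\omega+1}=s^\omega s$. A homomorphism of semigroups $\alpha:S\to T$ is an epimorphism if, for all semigroups $R$ and homomorphisms $\beta,\gamma:T\to R$, $\beta\circ\alpha=\gamma\circ\alpha$ implies $\beta=\gamma$. For a subsemigroup $U$ of a semigroup $T$, the dominion $\mathrm{Dom}(U,T)$ is the set of all $d\in T$ such that, for every semigroup $R$, any two homomorphisms $T\to R$ that agree on $U$ also agree at $d$. A finite semigroup $S$ is F-saturated if $\mathrm{Dom}(S,T)\ne T$ for every finite semigroup $T$ properly containing $S$ as a subsemigroup. A class of finite semigroups is F-saturated if all its members are F-saturated. A class $\mathcal{C}$ of finite semigroups is F-epimorphically closed if, for every epimorphism $S\to T$ with $T$ a finite semigroup, if $S\in\mathcal{C}$ then $T\in\mathcal{C}$. $B_2=\langle a,b: aba=a,\ bab=b,\ a^2=b^2=0\rangle$ is the five-element aperiodic Brandt semigroup (with zero $0$), and $Y=\{ab,a,ba,0\}=B_2\setminus\{b\}$, a subsemigroup of $B_2$. A pseudovariety has decidable membership problem if there is an algorithm deciding whether a given finite semigroup belongs to it. *)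

theory Defs
  imports "HOL-Library.FuncSet" "HOL-Library.Countable_Set"
begin

section \<open>Semigroups\<close>

text \<open>Semigroups are nonempty. The operation is only constrained on the carrier; all classes of
  semigroups considered below are closed under isomorphism, so its values elsewhere do not matter.\<close>

record 'a semigrp =
  carrier :: "'a set"
  mult :: "'a \<Rightarrow> 'a \<Rightarrow> 'a"  (infixl "\<cdot>\<index>" 70)

definition is_semigroup :: "'a semigrp \<Rightarrow> bool" where
  "is_semigroup S \<longleftrightarrow> carrier S \<noteq> {} \<and>
     (\<forall>x \<in> carrier S. \<forall>y \<in> carrier S. x \<cdot>\<^bsub>S\<^esub> y \<in> carrier S) \<and>
     (\<forall>x \<in> carrier S. \<forall>y \<in> carrier S. \<forall>z \<in> carrier S.
        (x \<cdot>\<^bsub>S\<^esub> y) \<cdot>\<^bsub>S\<^esub> z = x \<cdot>\<^bsub>S\<^esub> (y \<cdot>\<^bsub>S\<^esub> z))"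

definition finite_semigroup :: "'a semigrp \<Rightarrow> bool" where
  "finite_semigroup S \<longleftrightarrow> is_semigroup S \<and> finite (carrier S)"

definition shom :: "'a semigrp \<Rightarrow> 'b semigrp \<Rightarrow> ('a \<Rightarrow> 'b) set" where
  "shom S T = {h. (\<forall>x \<in> carrier S. h x \<in> carrier T) \<and>
     (\<forall>x \<in> carrier S. \<forall>y \<in> carrier S. h (x \<cdot>\<^bsub>S\<^esub> y) = h x \<cdot>\<^bsub>T\<^esub> h y)}"

definition isomorphic :: "'a semigrp \<Rightarrow> 'b semigrp \<Rightarrow> bool" where
  "isomorphic S T \<longleftrightarrow> (\<exists>h \<in> shom S T. bij_betw h (carrier S) (carrier T))"

definition subsemigroup :: "'a semigrp \<Rightarrow> 'a semigrp \<Rightarrow> bool" where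
  "subsemigroup S T \<longleftrightarrow> is_semigroup S \<and> carrier S \<subseteq> carrier T \<and>
     (\<forall>x \<in> carrier S. \<forall>y \<in> carrier S. x \<cdot>\<^bsub>S\<^esub> y = x \<cdot>\<^bsub>T\<^esub> y)"

definition product_semigroup :: "'i set \<Rightarrow> ('i \<Rightarrow> 'a semigrp) \<Rightarrow> ('i \<Rightarrow> 'a) semigrp" where
  "product_semigroup I F =
     \<lparr>carrier = (\<Pi>\<^sub>E i\<in>I. carrier (F i)), mult = (\<lambda>x y. \<lambda>i\<in>I. x i \<cdot>\<^bsub>F i\<^esub> y i)\<rparr>"

definition idempotent :: "'a semigrp \<Rightarrow> 'a \<Rightarrow> bool" where
  "idempotent S e \<longleftrightarrow> e \<in> carrier S \<and> e \<cdot>\<^bsub>S\<^esub> e = e"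

text \<open>There is no unit, so the exponent is shifted: the value at \<open>n\<close> is the power with exponent
  \<open>n + 1\<close>.\<close>

primrec power_Suc :: "'a semigrp \<Rightarrow> 'a \<Rightarrow> nat \<Rightarrow> 'a" where
  "power_Suc S s 0 = s"
| "power_Suc S s (Suc n) = power_Suc S s n \<cdot>\<^bsub>S\<^esub> s"

definition omega :: "'a semigrp \<Rightarrow> 'a \<Rightarrow> 'a" where
  "omega S s = (THE e. idempotent S e \<and> (\<exists>n. e = power_Suc S s n))"

definition omega_plus_1 :: "'a semigrp \<Rightarrow> 'a \<Rightarrow> 'a" where
  "omega_plus_1 S s = omega S s \<cdot>\<^bsub>S\<^esub> s"


section \<open>Epimorphisms, dominions and saturation\<close>

text \<open>A definition cannot quantify over all types, so the codomains \<open>R\<close> of the test homomorphisms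
  range over all semigroups whose elements are taken from a universe type \<open>'r\<close>. For finite
  \<open>T\<close>, all infinite types give the same dominions and epimorphisms, and these are also
  respected by test homomorphisms into semigroups of any other type
  (\<open>dominion_universe\<close>, \<open>epimorphism_universe\<close>).\<close>

definition epimorphism ::
    "'r itself \<Rightarrow> 'a semigrp \<Rightarrow> 'b semigrp \<Rightarrow> ('a \<Rightarrow> 'b) \<Rightarrow> bool" where
  "epimorphism u S T \<alpha> \<longleftrightarrow> \<alpha> \<in> shom S T \<and>
     (\<forall>R :: 'r semigrp. is_semigroup R \<longrightarrow>
       (\<forall>\<beta> \<in> shom T R. \<forall>\<gamma> \<in> shom T R.
          (\<forall>s \<in> carrier S. \<beta> (\<alpha> s) = \<gamma> (\<alpha> s)) \<longrightarrow> (\<forall>t \<in> carrier T. \<beta> t = \<gamma> t)))"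

definition dominion :: "'r itself \<Rightarrow> 'a set \<Rightarrow> 'a semigrp \<Rightarrow> 'a set" where
  "dominion u A T = {d \<in> carrier T. \<forall>R :: 'r semigrp. is_semigroup R \<longrightarrow>
     (\<forall>\<beta> \<in> shom T R. \<forall>\<gamma> \<in> shom T R. (\<forall>a \<in> A. \<beta> a = \<gamma> a) \<longrightarrow> \<beta> d = \<gamma> d)}"

lemma dominion_universe:
  assumes inf: "infinite (UNIV :: 'r set)" and T: "finite_semigroup T"
  shows "dominion TYPE('r) A T \<subseteq> dominion TYPE('s) A T"
proof
  fix d assume d: "d \<in> dominion TYPE('r) A T"
  have "\<beta> d = \<gamma> d"
    if R: "is_semigroup R" and \<beta>: "\<beta> \<in> shom T R" and \<gamma>: "\<gamma> \<in> shom T R"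
      and agree: "\<forall>a \<in> A. \<beta> a = \<gamma> a"
    for R :: "'s semigrp" and \<beta> \<gamma>
  proof -
    define m where "m = mult R"
    define B where "B = \<beta> ` carrier T \<union> \<gamma> ` carrier T"
    define W where "W = (\<lambda>(x, xs). foldl m x xs) ` (B \<times> lists B)"
    have BR: "B \<subseteq> carrier R" using \<beta> \<gamma> by (auto simp: B_def shom_def)
    have cl: "m x y \<in> carrier R" if "x \<in> carrier R" "y \<in> carrier R" for x y
      using R that by (auto simp: is_semigroup_def m_def)
    have as: "m (m x y) z = m x (m y z)"
      if "x \<in> carrier R" "y \<in> carrier R" "z \<in> carrier R" for x y z
      using R that by (auto simp: is_semigroup_def m_def)
    have fold_cl: "foldl m x xs \<in> carrier R" if "x \<in> carrier R" "xs \<in> lists B" for x xs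
      using that(2,1) by (induction xs arbitrary: x) (use BR cl in auto)
    have fold_as: "m w (foldl m x xs) = foldl m (m w x) xs"
      if "w \<in> carrier R" "x \<in> carrier R" "xs \<in> lists B" for w x xs
      using that(3,1,2)
    proof (induction xs arbitrary: x)
      case (Cons y ys)
      then show ?case using BR cl as by (simp add: subset_iff)
    qed simp
    have WR: "W \<subseteq> carrier R" using fold_cl BR by (auto simp: W_def)
    have BW: "B \<subseteq> W"
    proof
      fix b assume "b \<in> B"
      then have "(b, []) \<in> B \<times> lists B" by simp
      then show "b \<in> W" unfolding W_def by (rule rev_image_eqI) simp
    qed
    have Wcl: "m x y \<in> W" if "x \<in> W" "y \<in> W" for x y
    proof -
      obtain b bs c cs where b: "b \<in> B" "bs \<in> lists B" "x = foldl m b bs"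
        and c: "c \<in> B" "cs \<in> lists B" "y = foldl m c cs"
        using \<open>x \<in> W\<close> \<open>y \<in> W\<close> unfolding W_def by auto
      have "m x y = foldl m b (bs @ c # cs)"
        using b c fold_as[of x c cs] fold_cl[of b bs] BR by auto
      moreover have "(b, bs @ c # cs) \<in> B \<times> lists B" using b c by auto
      ultimately show ?thesis
        unfolding W_def by (intro image_eqI[where x = "(b, bs @ c # cs)"]) simp_all
    qed
    have "countable B"
      using T by (auto simp: B_def finite_semigroup_def intro!: countable_finite)
    then have "countable W"
      unfolding W_def by (intro countable_image countable_SIGMA countable_lists)
    then obtain g :: "'s \<Rightarrow> nat" where g: "inj_on g W" by (auto simp: countable_def)
    obtain h :: "nat \<Rightarrow> 'r" where h: "inj h"
      using inf infinite_countable_subset by blast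
    define f where "f = h \<circ> g"
    have f: "inj_on f W"
      using g h unfolding f_def by (meson comp_inj_on inj_on_subset subset_UNIV)
    define R' where "R' = \<lparr>carrier = f ` W,
      mult = (\<lambda>x y. f (m (inv_into W f x) (inv_into W f y)))\<rparr>"
    have R'm: "mult R' (f x) (f y) = f (m x y)" if "x \<in> W" "y \<in> W" for x y
      using that f by (simp add: R'_def)
    have R'c: "carrier R' = f ` W" by (simp add: R'_def)
    have TW: "\<beta> t \<in> W" "\<gamma> t \<in> W" if "t \<in> carrier T" for t
      using that BW by (auto simp: B_def)
    have "carrier T \<noteq> {}" using T by (simp add: finite_semigroup_def is_semigroup_def)
    then have "W \<noteq> {}" using TW by auto
    moreover have "m (m x y) z = m x (m y z)" if "x \<in> W" "y \<in> W" "z \<in> W" for x y z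
      using that WR as by (simp add: subset_iff)
    ultimately have "is_semigroup R'"
      unfolding is_semigroup_def R'c by (simp add: R'm Wcl)
    moreover have "f \<circ> \<beta> \<in> shom T R'"
      using \<beta> TW by (simp add: shom_def R'c R'm m_def)
    moreover have "f \<circ> \<gamma> \<in> shom T R'"
      using \<gamma> TW by (simp add: shom_def R'c R'm m_def)
    moreover have "\<forall>a \<in> A. (f \<circ> \<beta>) a = (f \<circ> \<gamma>) a" using agree by simp
    ultimately have "(f \<circ> \<beta>) d = (f \<circ> \<gamma>) d"
      using d unfolding dominion_def by blast
    moreover have "d \<in> carrier T" using d by (simp add: dominion_def)
    ultimately show ?thesis using f TW by (simp add: inj_on_eq_iff)
  qed
  then show "d \<in> dominion TYPE('s) A T" using d by (simp add: dominion_def)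
qed

lemma epimorphism_iff_dominion:
  "epimorphism u S T \<alpha> \<longleftrightarrow> \<alpha> \<in> shom S T \<and> dominion u (\<alpha> ` carrier S) T = carrier T"
  unfolding epimorphism_def dominion_def by auto

lemma epimorphism_universe:
  assumes "infinite (UNIV :: 'r set)" "finite_semigroup T" "epimorphism TYPE('r) S T \<alpha>"
  shows "epimorphism TYPE('s) S T \<alpha>"
proof -
  have "dominion TYPE('s) (\<alpha> ` carrier S) T \<subseteq> carrier T" by (auto simp: dominion_def)
  with assms(3) dominion_universe[OF assms(1,2), of "\<alpha> ` carrier S", where 's='s]
  show ?thesis unfolding epimorphism_iff_dominion by auto
qed

text \<open>Every finite semigroup is isomorphic to one with elements in \<open>nat\<close>, and any finite
  extension of a finite semigroup on \<open>nat\<close> has a copy on \<open>nat\<close> over it. Accordingly,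
  (isomorphism-closed) classes of finite semigroups are sets of finite semigroups on \<open>nat\<close>.\<close>

definition F_saturated_semigroup :: "'r itself \<Rightarrow> nat semigrp \<Rightarrow> bool" where
  "F_saturated_semigroup u S \<longleftrightarrow> finite_semigroup S \<and>
     (\<forall>T :: nat semigrp. finite_semigroup T \<and> subsemigroup S T \<and> carrier S \<noteq> carrier T \<longrightarrow>
        dominion u (carrier S) T \<noteq> carrier T)"

definition F_saturated :: "'r itself \<Rightarrow> nat semigrp set \<Rightarrow> bool" where
  "F_saturated u C \<longleftrightarrow> (\<forall>S \<in> C. F_saturated_semigroup u S)"

definition F_epi_closed :: "'r itself \<Rightarrow> nat semigrp set \<Rightarrow> bool" where
  "F_epi_closed u C \<longleftrightarrow> (\<forall>(S :: nat semigrp) (T :: nat semigrp) \<alpha>.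
     S \<in> C \<and> finite_semigroup T \<and> epimorphism u S T \<alpha> \<longrightarrow> T \<in> C)"


section \<open>Pseudovarieties\<close>

definition finite_semigroups :: "nat semigrp set" where
  "finite_semigroups = {S. finite_semigroup S}"

definition belongs_to :: "'a semigrp \<Rightarrow> nat semigrp set \<Rightarrow> bool" where
  "belongs_to S C \<longleftrightarrow> (\<exists>T \<in> C. isomorphic S T)"

text \<open>Closure under finite products includes the empty product, so the one-element semigroup is
  always a member.\<close>

definition pseudovariety :: "nat semigrp set \<Rightarrow> bool" where
  "pseudovariety V \<longleftrightarrow> V \<subseteq> finite_semigroups \<and>
     (\<forall>S T h. S \<in> V \<and> finite_semigroup T \<and> h \<in> shom S T \<and> h ` carrier S = carrier T \<longrightarrow> T \<in> V) \<and>
     (\<forall>S T. S \<in> V \<and> subsemigroup T S \<longrightarrow> T \<in> V) \<and>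
     (\<forall>(n :: nat) F. (\<forall>i < n. F i \<in> V) \<longrightarrow> belongs_to (product_semigroup {..<n} F) V)"

definition V1 :: "nat semigrp set" where
  "V1 = {S. finite_semigroup S \<and>
     (\<forall>x \<in> carrier S. \<forall>e f. idempotent S e \<and> idempotent S f \<longrightarrow>
        omega_plus_1 S (e \<cdot>\<^bsub>S\<^esub> x \<cdot>\<^bsub>S\<^esub> f) = e \<cdot>\<^bsub>S\<^esub> x \<cdot>\<^bsub>S\<^esub> f)}"

definition V2 :: "nat semigrp set" where
  "V2 = {S. finite_semigroup S \<and>
     (\<forall>x \<in> carrier S. \<forall>e f. idempotent S e \<and> idempotent S f \<longrightarrow>
        e \<cdot>\<^bsub>S\<^esub> x \<cdot>\<^bsub>S\<^esub> f \<cdot>\<^bsub>S\<^esub> omega S (e \<cdot>\<^bsub>S\<^esub> f) = e \<cdot>\<^bsub>S\<^esub> x \<cdot>\<^bsub>S\<^esub> f)}"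

definition V3 :: "nat semigrp set" where
  "V3 = {S. finite_semigroup S \<and>
     (\<forall>x \<in> carrier S. \<forall>e f. idempotent S e \<and> idempotent S f \<longrightarrow>
        omega S (e \<cdot>\<^bsub>S\<^esub> f) \<cdot>\<^bsub>S\<^esub> (e \<cdot>\<^bsub>S\<^esub> x \<cdot>\<^bsub>S\<^esub> f) = e \<cdot>\<^bsub>S\<^esub> x \<cdot>\<^bsub>S\<^esub> f)}"

definition alternative_1 :: "'r itself \<Rightarrow> nat semigrp set \<Rightarrow> bool" where
  "alternative_1 u V \<longleftrightarrow> F_saturated u V \<and> F_epi_closed u V \<and> (V \<subseteq> V1 \<or> V \<subseteq> V2 \<or> V \<subseteq> V3)"

definition alternative_2 :: "'r itself \<Rightarrow> nat semigrp set \<Rightarrow> bool" where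
  "alternative_2 u V \<longleftrightarrow> \<not> F_saturated u V \<and>
     \<not> (\<exists>W. pseudovariety W \<and> W \<noteq> finite_semigroups \<and> F_epi_closed u W \<and> V \<subseteq> W)"


section \<open>The semigroups \<open>B\<^sub>2\<close> and \<open>Y\<close>\<close>

datatype brandt = B2_0 | B2_a | B2_b | B2_ab | B2_ba

text \<open>The multiplication table of the matrix units \<open>B2_a = e\<^sub>1\<^sub>2\<close>, \<open>B2_b = e\<^sub>2\<^sub>1\<close>,
  \<open>B2_ab = e\<^sub>1\<^sub>1\<close>, \<open>B2_ba = e\<^sub>2\<^sub>2\<close>. The lemmas following it identify it with the
  semigroup with zero presented by \<open>aba = a\<close>, \<open>bab = b\<close>, \<open>a\<^sup>2 = b\<^sup>2 = 0\<close>.\<close>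

fun brandt_mult :: "brandt \<Rightarrow> brandt \<Rightarrow> brandt" where
  "brandt_mult B2_a B2_b = B2_ab"
| "brandt_mult B2_a B2_ba = B2_a"
| "brandt_mult B2_b B2_a = B2_ba"
| "brandt_mult B2_b B2_ab = B2_b"
| "brandt_mult B2_ab B2_a = B2_a"
| "brandt_mult B2_ab B2_ab = B2_ab"
| "brandt_mult B2_ba B2_b = B2_b"
| "brandt_mult B2_ba B2_ba = B2_ba"
| "brandt_mult _ _ = B2_0"

definition B2 :: "brandt semigrp" where
  "B2 = \<lparr>carrier = {B2_0, B2_a, B2_b, B2_ab, B2_ba}, mult = brandt_mult\<rparr>"

definition Y_semigroup :: "brandt semigrp" where
  "Y_semigroup = \<lparr>carrier = {B2_ab, B2_a, B2_ba, B2_0}, mult = brandt_mult\<rparr>"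

lemma brandt_mult_assoc:
  "brandt_mult (brandt_mult x y) z = brandt_mult x (brandt_mult y z)"
  by (cases x; cases y; cases z) simp_all

lemma B2_semigroup: "finite_semigroup B2"
  by (auto simp: finite_semigroup_def is_semigroup_def B2_def brandt_mult_assoc)

lemma Y_subsemigroup: "subsemigroup Y_semigroup B2" "carrier Y_semigroup = carrier B2 - {B2_b}"
  by (auto simp: subsemigroup_def is_semigroup_def Y_semigroup_def B2_def brandt_mult_assoc)

lemma B2_relations:
  "B2_a \<cdot>\<^bsub>B2\<^esub> B2_b \<cdot>\<^bsub>B2\<^esub> B2_a = B2_a" "B2_b \<cdot>\<^bsub>B2\<^esub> B2_a \<cdot>\<^bsub>B2\<^esub> B2_b = B2_b"
  "B2_a \<cdot>\<^bsub>B2\<^esub> B2_a = B2_0" "B2_b \<cdot>\<^bsub>B2\<^esub> B2_b = B2_0"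
  "B2_a \<cdot>\<^bsub>B2\<^esub> B2_b = B2_ab" "B2_b \<cdot>\<^bsub>B2\<^esub> B2_a = B2_ba" "B2_0 \<cdot>\<^bsub>B2\<^esub> x = B2_0" "x \<cdot>\<^bsub>B2\<^esub> B2_0 = B2_0"
  by (cases x; simp add: B2_def)+

lemma B2_universal:
  assumes R: "is_semigroup R" and "a \<in> carrier R" "b \<in> carrier R" "z \<in> carrier R"
    and zero: "\<And>x. x \<in> carrier R \<Longrightarrow> z \<cdot>\<^bsub>R\<^esub> x = z" "\<And>x. x \<in> carrier R \<Longrightarrow> x \<cdot>\<^bsub>R\<^esub> z = z"
    and rel: "a \<cdot>\<^bsub>R\<^esub> b \<cdot>\<^bsub>R\<^esub> a = a" "b \<cdot>\<^bsub>R\<^esub> a \<cdot>\<^bsub>R\<^esub> b = b" "a \<cdot>\<^bsub>R\<^esub> a = z" "b \<cdot>\<^bsub>R\<^esub> b = z"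
  shows "\<exists>h \<in> shom B2 R. h B2_a = a \<and> h B2_b = b \<and> h B2_0 = z"
proof
  let ?h = "case_brandt z a b (a \<cdot>\<^bsub>R\<^esub> b) (b \<cdot>\<^bsub>R\<^esub> a)"
  have cl: "x \<cdot>\<^bsub>R\<^esub> y \<in> carrier R" if "x \<in> carrier R" "y \<in> carrier R" for x y
    using R that by (auto simp: is_semigroup_def)
  have as: "x \<cdot>\<^bsub>R\<^esub> y \<cdot>\<^bsub>R\<^esub> w = x \<cdot>\<^bsub>R\<^esub> (y \<cdot>\<^bsub>R\<^esub> w)"
    if "x \<in> carrier R" "y \<in> carrier R" "w \<in> carrier R" for x y w
    using R that by (auto simp: is_semigroup_def)
  note cs = assms(2-4)
  have l: "a \<cdot>\<^bsub>R\<^esub> (a \<cdot>\<^bsub>R\<^esub> x) = z" "b \<cdot>\<^bsub>R\<^esub> (b \<cdot>\<^bsub>R\<^esub> x) = z" if "x \<in> carrier R" for x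
    using that cs as[symmetric] rel zero by simp_all
  have m: "a \<cdot>\<^bsub>R\<^esub> (b \<cdot>\<^bsub>R\<^esub> a) = a" "b \<cdot>\<^bsub>R\<^esub> (a \<cdot>\<^bsub>R\<^esub> b) = b"
    using cs as[symmetric] rel by simp_all
  have eq: "?h (brandt_mult x y) = ?h x \<cdot>\<^bsub>R\<^esub> ?h y" for x y
    using cs by (cases x; cases y) (simp_all add: cl as l m rel zero)
  show "?h \<in> shom B2 R"
    using eq cs cl unfolding shom_def by (auto simp: B2_def simp del: brandt_mult.simps)
  show "?h B2_a = a \<and> ?h B2_b = b \<and> ?h B2_0 = z" by simp
qed


section \<open>Algorithms\<close>

text \<open>The model of computation is combinatory logic with weak reduction. Natural numbers,
  lists and combinatory terms are passed as closed normal forms by Scott's encoding: a value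
  built with the \<open>i\<close>-th of the \<open>k\<close> constructors of its datatype is encoded
  by a term that takes \<open>k\<close> arguments and applies the \<open>i\<close>-th of them to the
  encodings of the constructor arguments.\<close>

datatype comb = S_comb | K_comb | Ap comb comb  (infixl "\<bullet>" 90)

inductive weak_step :: "comb \<Rightarrow> comb \<Rightarrow> bool" where
  K: "weak_step (K_comb \<bullet> x \<bullet> y) x"
| S: "weak_step (S_comb \<bullet> x \<bullet> y \<bullet> z) (x \<bullet> z \<bullet> (y \<bullet> z))"
| left: "weak_step x x' \<Longrightarrow> weak_step (x \<bullet> y) (x' \<bullet> y)"
| right: "weak_step y y' \<Longrightarrow> weak_step (x \<bullet> y) (x \<bullet> y')"

abbreviation reduces_to :: "comb \<Rightarrow> comb \<Rightarrow> bool" (infix "\<rightarrow>\<^sub>w" 50) where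
  "t \<rightarrow>\<^sub>w u \<equiv> weak_step\<^sup>*\<^sup>* t u"

definition I_comb :: comb where
  "I_comb = S_comb \<bullet> K_comb \<bullet> K_comb"

definition true_comb :: comb where
  "true_comb = K_comb"

definition false_comb :: comb where
  "false_comb = K_comb \<bullet> I_comb"

definition encode_bool :: "bool \<Rightarrow> comb" where
  "encode_bool b = (if b then true_comb else false_comb)"

text \<open>\<open>tuple1 x\<close> is \<open>\<lambda>f. f x\<close> and \<open>tuple2 x y\<close> is \<open>\<lambda>f. f x y\<close>.\<close>

definition tuple1 :: "comb \<Rightarrow> comb" where
  "tuple1 x = S_comb \<bullet> I_comb \<bullet> (K_comb \<bullet> x)"

definition tuple2 :: "comb \<Rightarrow> comb \<Rightarrow> comb" where
  "tuple2 x y = S_comb \<bullet> tuple1 x \<bullet> (K_comb \<bullet> y)"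

lemma reduces_app: "t \<rightarrow>\<^sub>w t' \<Longrightarrow> t \<bullet> u \<rightarrow>\<^sub>w t' \<bullet> u"
  by (induction rule: rtranclp_induct) (auto intro: weak_step.left rtranclp.rtrancl_into_rtrancl)

lemma reduces_app2: "u \<rightarrow>\<^sub>w u' \<Longrightarrow> t \<bullet> u \<rightarrow>\<^sub>w t \<bullet> u'"
  by (induction rule: rtranclp_induct) (auto intro: weak_step.right rtranclp.rtrancl_into_rtrancl)

lemma reduces_K: "K_comb \<bullet> x \<bullet> y \<rightarrow>\<^sub>w x"
  by (auto intro: weak_step.K)

lemma reduces_S: "S_comb \<bullet> x \<bullet> y \<bullet> z \<rightarrow>\<^sub>w x \<bullet> z \<bullet> (y \<bullet> z)"
  by (auto intro: weak_step.S)

lemma reduces_I: "I_comb \<bullet> x \<rightarrow>\<^sub>w x"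
  unfolding I_comb_def by (rule rtranclp_trans[OF reduces_S reduces_K])

lemma reduces_tuple1: "tuple1 x \<bullet> f \<rightarrow>\<^sub>w f \<bullet> x"
  unfolding tuple1_def
  by (meson reduces_S reduces_I reduces_K reduces_app reduces_app2 rtranclp_trans)

lemma reduces_tuple2: "tuple2 x y \<bullet> f \<rightarrow>\<^sub>w f \<bullet> x \<bullet> y"
  unfolding tuple2_def
  by (meson reduces_S reduces_tuple1 reduces_K reduces_app reduces_app2 rtranclp_trans)

primrec encode_nat :: "nat \<Rightarrow> comb" where
  "encode_nat 0 = K_comb"
| "encode_nat (Suc n) = K_comb \<bullet> tuple1 (encode_nat n)"

primrec encode_list :: "('a \<Rightarrow> comb) \<Rightarrow> 'a list \<Rightarrow> comb" where
  "encode_list c [] = K_comb"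
| "encode_list c (x # xs) = K_comb \<bullet> tuple2 (c x) (encode_list c xs)"

primrec encode_comb :: "comb \<Rightarrow> comb" where
  "encode_comb S_comb = S_comb \<bullet> (K_comb \<bullet> K_comb) \<bullet> K_comb"
| "encode_comb K_comb = K_comb \<bullet> K_comb"
| "encode_comb (t \<bullet> u) = K_comb \<bullet> (K_comb \<bullet> tuple2 (encode_comb t) (encode_comb u))"

lemma encode_comb_case:
  "encode_comb S_comb \<bullet> a \<bullet> b \<bullet> c \<rightarrow>\<^sub>w a"
  "encode_comb K_comb \<bullet> a \<bullet> b \<bullet> c \<rightarrow>\<^sub>w b"
  "encode_comb (t \<bullet> u) \<bullet> a \<bullet> b \<bullet> c \<rightarrow>\<^sub>w c \<bullet> encode_comb t \<bullet> encode_comb u"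
  unfolding encode_comb.simps
  by (meson reduces_S reduces_K reduces_tuple2 reduces_app rtranclp_trans)+

text \<open>A semigroup with elements \<open>0, \<dots>, n - 1\<close> is given to an algorithm by the list of
  the rows of its multiplication table. Up to isomorphism, these are all finite semigroups.\<close>

definition encode_semigroup :: "nat semigrp \<Rightarrow> comb" where
  "encode_semigroup S = (let n = card (carrier S) in
     encode_list (encode_list encode_nat) (map (\<lambda>i. map (\<lambda>j. i \<cdot>\<^bsub>S\<^esub> j) [0..<n]) [0..<n]))"

definition decides_membership :: "comb \<Rightarrow> nat semigrp set \<Rightarrow> bool" where
  "decides_membership p C \<longleftrightarrow> (\<forall>S n. finite_semigroup S \<and> carrier S = {..<n} \<longrightarrow>
     p \<bullet> encode_semigroup S \<rightarrow>\<^sub>w encode_bool (S \<in> C))"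


subsection \<open>Outputs are well defined\<close>

inductive par_step :: "comb \<Rightarrow> comb \<Rightarrow> bool" where
  refl: "par_step x x"
| K: "par_step x x' \<Longrightarrow> par_step (K_comb \<bullet> x \<bullet> y) x'"
| S: "par_step x x' \<Longrightarrow> par_step y y' \<Longrightarrow> par_step z z' \<Longrightarrow>
      par_step (S_comb \<bullet> x \<bullet> y \<bullet> z) (x' \<bullet> z' \<bullet> (y' \<bullet> z'))"
| app: "par_step x x' \<Longrightarrow> par_step y y' \<Longrightarrow> par_step (x \<bullet> y) (x' \<bullet> y')"

inductive_cases par_S: "par_step S_comb u"
inductive_cases par_K: "par_step K_comb u"
inductive_cases par_app: "par_step (x \<bullet> y) u"

lemma par_K1: "par_step (K_comb \<bullet> x) u \<Longrightarrow> \<exists>x'. u = K_comb \<bullet> x' \<and> par_step x x'"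
  by (auto elim!: par_app par_K intro: par_step.refl)

lemma par_S1: "par_step (S_comb \<bullet> x) u \<Longrightarrow> \<exists>x'. u = S_comb \<bullet> x' \<and> par_step x x'"
  by (auto elim!: par_app par_S intro: par_step.refl)

lemma par_S2:
  "par_step (S_comb \<bullet> x \<bullet> y) u \<Longrightarrow> \<exists>x' y'. u = S_comb \<bullet> x' \<bullet> y' \<and> par_step x x' \<and> par_step y y'"
  by (erule par_app) (auto dest: par_S1 intro: par_step.refl)

lemma par_step_diamond:
  "par_step t u \<Longrightarrow> par_step t v \<Longrightarrow> \<exists>w. par_step u w \<and> par_step v w"
proof (induction arbitrary: v rule: par_step.induct)
  case (refl x)
  then show ?case by (blast intro: par_step.refl)
next
  case (K x x' y)
  from K.prems show ?case
    by (rule par_app) (use K in \<open>blast dest!: par_K1 intro: par_step.intros\<close>)+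
next
  case (S x x' y y' z z')
  from S.prems show ?case
    by (rule par_app) (use S in \<open>(blast dest!: par_S2 intro: par_step.intros)\<close>)+
next
  case (app x x' y y')
  from app.prems show ?case
  proof (rule par_app)
    assume "v = x \<bullet> y"
    then show ?thesis using app by (blast intro: par_step.intros)
  next
    fix p assume x: "x = K_comb \<bullet> p" and p: "par_step p v"
    obtain p' where x': "x' = K_comb \<bullet> p'" using app.hyps(1) x par_K1 by blast
    have "par_step x (K_comb \<bullet> v)" using x p by (auto intro: par_step.intros)
    then obtain w where "par_step x' w" "par_step (K_comb \<bullet> v) w" using app.IH(1) by blast
    then show ?thesis using x' by (blast dest: par_K1 intro: par_step.intros)
  next
    fix p p' q q' z
    assume x: "x = S_comb \<bullet> p \<bullet> q" and v: "v = p' \<bullet> z \<bullet> (q' \<bullet> z)"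
      and pq: "par_step p p'" "par_step q q'" and z: "par_step y z"
    obtain p2 q2 where x': "x' = S_comb \<bullet> p2 \<bullet> q2" using app.hyps(1) x par_S2 by blast
    have "par_step x (S_comb \<bullet> p' \<bullet> q')" using x pq by (auto intro: par_step.intros)
    then obtain w where w: "par_step x' w" "par_step (S_comb \<bullet> p' \<bullet> q') w"
      using app.IH(1) by blast
    then obtain p3 q3 where "w = S_comb \<bullet> p3 \<bullet> q3" "par_step p' p3" "par_step q' q3"
      using par_S2 by blast
    moreover have "par_step p2 p3" "par_step q2 q3"
      using w(1) x' calculation(1) by (auto dest!: par_S2)
    moreover obtain z' where "par_step y' z'" "par_step z z'" using app.IH(2) z by blast
    ultimately show ?thesis unfolding x' v by (blast intro: par_step.intros)
  next
    fix p q assume "v = p \<bullet> q" "par_step x p" "par_step y q"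
    then show ?thesis using app.IH by (blast intro: par_step.intros)
  qed
qed

lemma par_steps_confluent:
  "par_step\<^sup>*\<^sup>* t u \<Longrightarrow> par_step\<^sup>*\<^sup>* t v \<Longrightarrow> \<exists>w. par_step\<^sup>*\<^sup>* u w \<and> par_step\<^sup>*\<^sup>* v w"
proof -
  have strip: "\<exists>w. par_step\<^sup>*\<^sup>* u w \<and> par_step v w" if "par_step\<^sup>*\<^sup>* t v" "par_step t u" for t u v
    using that
  proof (induction arbitrary: u rule: rtranclp_induct)
    case (step y z)
    then show ?case by (meson par_step_diamond rtranclp.rtrancl_into_rtrancl)
  qed blast
  show "par_step\<^sup>*\<^sup>* t u \<Longrightarrow> par_step\<^sup>*\<^sup>* t v \<Longrightarrow> ?thesis"
  proof (induction rule: rtranclp_induct)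
    case (step y z)
    then show ?case by (meson strip rtranclp.rtrancl_into_rtrancl)
  qed blast
qed

lemma weak_step_par_step: "weak_step t u \<Longrightarrow> par_step t u"
  by (induction rule: weak_step.induct) (auto intro: par_step.intros)

lemma encode_bool_normal: "par_step\<^sup>*\<^sup>* (encode_bool b) u \<Longrightarrow> u = encode_bool b"
proof (induction rule: rtranclp_induct)
  case (step y z)
  then show ?case
    by (auto simp: encode_bool_def true_comb_def false_comb_def I_comb_def split: if_splits
        elim!: par_K par_S dest!: par_K1 par_S2)
qed simp

lemma reduces_to_bool_unique:
  assumes "t \<rightarrow>\<^sub>w encode_bool b" "t \<rightarrow>\<^sub>w encode_bool c"
  shows "b = c"
proof -
  have "par_step\<^sup>*\<^sup>* t u" if "t \<rightarrow>\<^sub>w u" for u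
    using that weak_step_par_step by (metis mono_rtranclp)
  with assms obtain w where "par_step\<^sup>*\<^sup>* (encode_bool b) w" "par_step\<^sup>*\<^sup>* (encode_bool c) w"
    using par_steps_confluent by blast
  then have "encode_bool b = encode_bool c" using encode_bool_normal by metis
  then show ?thesis
    by (auto simp: encode_bool_def true_comb_def false_comb_def split: if_splits)
qed

end

theory Submission
  imports Defs
begin

text \<open>Let \<open>S\<close> satisfy one of the three identities, let \<open>T\<close> be a finite extension of \<open>S\<close> that is
  dominated by \<open>S\<close>, and let \<open>d\<close> be a \<open>J\<close>-maximal element of \<open>T - S\<close>. Dominance gives
  \<open>d = x u y\<close> with \<open>x\<close>, \<open>y\<close> outside \<open>S\<close> and \<open>u\<close>, \<open>u y\<close> in \<open>S\<close>. The same kind of factorization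
  of \<open>x\<close> and \<open>y\<close>, taken at elements that are maximal also for right or left multiplication by \<open>S\<close>,
  gives \<open>x = x' g a\<close> and \<open>y = b k y'\<close> with idempotents \<open>g\<close>, \<open>k\<close> of \<open>S\<close> in the \<open>J\<close>-class of \<open>d\<close>.
  Each of the identities makes \<open>w = g a u b k\<close> left invertible over \<open>k\<close>, within \<open>S\<close>. Since \<open>w y'\<close>
  is in \<open>S\<close>, so are \<open>k y'\<close> and \<open>y\<close>, a contradiction.

  Conversely, if \<open>V\<close> is contained in none of \<open>V\<^sub>1\<close>, \<open>V\<^sub>2\<close>, \<open>V\<^sub>3\<close>, then some member has an element
  \<open>a = e x f\<close> failing all three identities. A word in \<open>e\<close>, \<open>f\<close>, \<open>a\<close> with the value \<open>a\<close> is then in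
  \<open>e\<^sup>*af\<^sup>*\<close> or without the letter \<open>a\<close> (after a change of \<open>e\<close> and \<open>f\<close> if \<open>a\<close> is regular), which
  makes \<open>Y\<close> a divisor of the square. Finally, for every finite semigroup \<open>S\<close>,
  the pseudovariety generated by \<open>Y\<close> contains a subsemigroup of the two by two Brandt semigroup
  over \<open>S\<^sup>1\<close> that dominates it.\<close>

section \<open>Finite monoids\<close>

text \<open>Among the elements above \<open>t\<close>, one whose up-set has least cardinality is
  maximal: anything above it has an up-set contained in its own, hence equal to it.\<close>

lemma finite_preorder_has_maximal:
  assumes "finite A" "t \<in> A" and refl: "\<And>x. x \<in> A \<Longrightarrow> le x x"
    and trans: "\<And>x y z. le x y \<Longrightarrow> le y z \<Longrightarrow> le x z"
  shows "\<exists>m \<in> A. le t m \<and> (\<forall>z \<in> A. le m z \<longrightarrow> le z m)"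
proof -
  define up where "up x = {z \<in> A. le x z}" for x
  obtain m where m: "m \<in> up t" "\<And>z. z \<in> up t \<Longrightarrow> card (up m) \<le> card (up z)"
    using ex_has_least_nat[of "\<lambda>z. z \<in> up t" t "\<lambda>z. card (up z)"] assms(2) refl
    unfolding up_def by auto
  have "le z m" if z: "z \<in> A" "le m z" for z
  proof -
    have "z \<in> up t" using m z trans unfolding up_def by blast
    moreover have sub: "up z \<subseteq> up m" using z trans unfolding up_def by blast
    moreover have "finite (up m)" using assms(1) unfolding up_def by simp
    ultimately have "up z = up m" using m(2) by (meson card_seteq)
    then have "m \<in> up z" using m(1) refl unfolding up_def by auto
    then show ?thesis by (simp add: up_def)
  qed
  then show ?thesis using m(1) unfolding up_def by blast
qed

section \<open>Idempotent powers and absorption in finite monoids\<close>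

context monoid_mult
begin

definition finite_submonoid :: "'a set \<Rightarrow> bool" where
  "finite_submonoid M \<longleftrightarrow> finite M \<and> 1 \<in> M \<and> (\<forall>x \<in> M. \<forall>y \<in> M. x * y \<in> M)"

lemma power_closed:
  assumes "\<And>x y. x \<in> A \<Longrightarrow> y \<in> A \<Longrightarrow> x * y \<in> A" "x \<in> A"
  shows "x ^ Suc n \<in> A"
  using assms by (induction n) auto

lemma finite_submonoid_power: "finite_submonoid M \<Longrightarrow> x \<in> M \<Longrightarrow> x ^ n \<in> M"
  by (induction n) (auto simp: finite_submonoid_def)

lemma power_repeats:
  assumes "finite_submonoid M" "x \<in> M"
  shows "\<exists>i j. 0 < j \<and> x ^ (i + j) = x ^ i"
proof -
  have "range (\<lambda>n. x ^ n) \<subseteq> M" using finite_submonoid_power[OF assms] by auto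
  then have "finite (range (\<lambda>n. x ^ n))"
    using assms(1) finite_subset unfolding finite_submonoid_def by blast
  then have "\<not> inj (\<lambda>n. x ^ n)" using finite_imageD by blast
  then obtain m n where "m \<noteq> n" "x ^ m = x ^ n" unfolding inj_def by auto
  then obtain m n where "m < n" "x ^ m = x ^ n" by (metis linorder_neqE_nat)
  then show ?thesis by (intro exI[of _ m] exI[of _ "n - m"]) simp
qed

lemma power_periodic:
  assumes "x ^ (i + j) = x ^ i" "i \<le> n"
  shows "x ^ (n + m * j) = x ^ n"
proof (induction m)
  case (Suc m)
  have "x ^ (n + Suc m * j) = x ^ (n - i + m * j) * x ^ (i + j)"
    using assms(2) by (simp add: power_add[symmetric] add_ac)
  also have "\<dots> = x ^ (n + m * j)"
    using assms by (simp add: power_add[symmetric] add_ac)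
  finally show ?case using Suc by simp
qed simp

lemma idempotent_power:
  assumes "finite_submonoid M" "x \<in> M"
  shows "\<exists>n. x ^ Suc n * x ^ Suc n = x ^ Suc n"
proof -
  obtain i j where ij: "0 < j" "x ^ (i + j) = x ^ i" using power_repeats[OF assms] by blast
  \<comment> \<open>A multiple of the period \<open>j\<close> that is positive and not below the
    preperiod \<open>i\<close>; doubling such an exponent does not change the power.\<close>
  define n where "n = Suc i * j"
  have "i \<le> n" "0 < n" using ij(1) unfolding n_def by (cases j; simp)+
  moreover have "x ^ n * x ^ n = x ^ n"
    using power_periodic[OF ij(2) \<open>i \<le> n\<close>, of "Suc i"] by (simp add: power_add[symmetric] n_def)
  ultimately show ?thesis by (metis Suc_pred)
qed

lemma power_sandwich: "a = p * a * q \<Longrightarrow> p ^ n * a * q ^ n = a"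
proof (induction n)
  case (Suc n)
  have "p ^ Suc n * a * q ^ Suc n = p ^ n * (p * a * q) * q ^ n"
    by (metis mult.assoc power_Suc power_Suc2)
  then show ?case using Suc by simp
qed simp

text \<open>Iteration gives \<open>a = p ^ i * a * q ^ i\<close> for every \<open>i\<close>. When
  \<open>i\<close> reaches the periodic range of the powers of \<open>p\<close>, another factor
  \<open>p ^ j\<close> on the left is absorbed.\<close>

lemma absorb_left:
  assumes "finite_submonoid M" "p \<in> M" "a = p * a * q"
  shows "\<exists>j. p ^ Suc j * a = a"
proof -
  obtain i j where ij: "0 < j" "p ^ (i + j) = p ^ i" using power_repeats[OF assms(1,2)] by blast
  have "p ^ j * a = p ^ j * (p ^ i * a * q ^ i)" using power_sandwich[OF assms(3)] by simp
  also have "\<dots> = a"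
    using power_sandwich[OF assms(3)] ij(2) by (metis add.commute mult.assoc power_add)
  finally show ?thesis using ij(1) by (metis Suc_pred)
qed

lemma absorb_right:
  assumes "finite_submonoid M" "q \<in> M" "a = p * a * q"
  shows "\<exists>j. a * q ^ Suc j = a"
proof -
  obtain i j where ij: "0 < j" "q ^ (i + j) = q ^ i" using power_repeats[OF assms(1,2)] by blast
  have "a * q ^ j = (p ^ i * a * q ^ i) * q ^ j" using power_sandwich[OF assms(3)] by simp
  also have "\<dots> = a"
    using power_sandwich[OF assms(3)] ij(2) by (metis mult.assoc power_add)
  finally show ?thesis using ij(1) by (metis Suc_pred)
qed

text \<open>Compare both exponents in the common power \<open>c ^ (Suc m * Suc n)\<close>: it fixes
  \<open>a\<close> as an iterate of \<open>c ^ Suc n\<close>, and it equals the idempotent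
  \<open>c ^ Suc m\<close>.\<close>

lemma fixed_by_idempotent_power:
  assumes "a * c ^ Suc n = a" "c ^ Suc m * c ^ Suc m = c ^ Suc m"
  shows "a * c ^ Suc m = a"
proof -
  have "(c ^ Suc m) ^ Suc k = c ^ Suc m" for k
    by (induction k) (use assms(2) in \<open>simp_all add: mult.assoc\<close>)
  moreover have "a * (c ^ Suc n) ^ k = a" for k
    by (induction k) (use assms(1) in \<open>simp_all add: mult.assoc[symmetric]\<close>)
  ultimately show ?thesis by (metis mult.commute power_mult)
qed

lemma fixed_by_idempotent_power':
  assumes "c ^ Suc n * a = a" "c ^ Suc m * c ^ Suc m = c ^ Suc m"
  shows "c ^ Suc m * a = a"
proof -
  have "(c ^ Suc m) ^ Suc k = c ^ Suc m" for k
    by (induction k) (use assms(2) in \<open>simp_all add: mult.assoc\<close>)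
  moreover have "(c ^ Suc n) ^ k * a = a" for k
    by (induction k) (use assms(1) in \<open>simp_all add: mult.assoc\<close>)
  ultimately show ?thesis by (metis mult.commute power_mult)
qed

text \<open>Reading the hypothesis as \<open>a = (p * a) * a * q\<close> and absorbing on the left
  yields \<open>a = r * a * a\<close> for some \<open>r\<close>, where the right multiplier is
  \<open>a\<close> itself. The contrapositive will show that an element outside all subgroups is not
  \<open>J\<close>-below its square.\<close>

lemma power_fixed_of_square_above:
  assumes M: "finite_submonoid M" "p \<in> M" "a \<in> M" and a: "a = p * (a * a) * q"
  shows "\<exists>j. a * a ^ Suc j = a"
proof -
  have "p * a \<in> M" using M unfolding finite_submonoid_def by blast
  then obtain j where "(p * a) ^ Suc j * a = a"
    using absorb_left[OF M(1), of "p * a" a q] a by (auto simp: mult.assoc)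
  then have "a = (p * a) ^ j * p * a * a" by (metis mult.assoc power_Suc2)
  then show ?thesis using absorb_right[OF M(1,3)] by blast
qed

section \<open>Green's \<open>J\<close>-preorder and factorizations through idempotents\<close>

definition J_le :: "'a set \<Rightarrow> 'a \<Rightarrow> 'a \<Rightarrow> bool" where
  "J_le M x y \<longleftrightarrow> (\<exists>p \<in> M. \<exists>q \<in> M. x = p * y * q)"

lemma J_le_refl: "finite_submonoid M \<Longrightarrow> J_le M x x"
  unfolding J_le_def finite_submonoid_def by force

lemma J_le_trans:
  assumes "finite_submonoid M" "J_le M x y" "J_le M y z"
  shows "J_le M x z"
proof -
  obtain p q r s where "p \<in> M" "q \<in> M" "x = p * y * q" "r \<in> M" "s \<in> M" "y = r * z * s"
    using assms(2,3) unfolding J_le_def by blast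
  then have "p * r \<in> M" "s * q \<in> M" "x = (p * r) * z * (s * q)"
    using assms(1) unfolding finite_submonoid_def by (auto simp: mult.assoc)
  then show ?thesis unfolding J_le_def by blast
qed

lemma J_leI: "p \<in> M \<Longrightarrow> q \<in> M \<Longrightarrow> x = p * y * q \<Longrightarrow> J_le M x y"
  unfolding J_le_def by blast

text \<open>The element \<open>c\<close> lies in the local monoid with identity \<open>k\<close>.
  Inserting \<open>k\<close> into \<open>k = p * c * q\<close> allows absorption on the left, which
  leaves \<open>k = r * k * c\<close>; absorption on the right then makes a power of
  \<open>c\<close> equal to \<open>k\<close>. So \<open>c\<close> is a unit of the local
  monoid.\<close>

lemma unit_power_of_J_le:
  assumes M: "finite_submonoid M" and "k \<in> M" "c \<in> M" and k: "k * k = k"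
    and c: "k * c = c" "c * k = c" and "J_le M k c"
  shows "\<exists>j. c ^ Suc j = k"
proof -
  obtain p q where pq: "p \<in> M" "q \<in> M" "k = p * c * q"
    using \<open>J_le M k c\<close> unfolding J_le_def by blast
  have "k = p * c * k * q" using pq c by (simp add: mult.assoc)
  moreover have "p * c \<in> M" using pq assms unfolding finite_submonoid_def by blast
  ultimately obtain j where "(p * c) ^ Suc j * k = k" using absorb_left[OF M] by metis
  then have "k = ((p * c) ^ j * p) * k * c" by (metis c mult.assoc power_Suc2)
  then obtain i where "k * c ^ Suc i = k" using absorb_right[OF M \<open>c \<in> M\<close>] by blast
  then have "c ^ Suc i = k" using c(1) by (metis mult.assoc power_Suc)
  then show ?thesis by blast
qed

text \<open>Take \<open>m\<close> above \<open>t\<close> maximal for right multiplication by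
  \<open>U\<close>. In a factorization \<open>m = x * u * y\<close> the factor \<open>x\<close> lies
  above \<open>m\<close>, so \<open>x = m * s\<close> and \<open>m = m * (s * u * y)\<close>. The
  stabilizing element is in \<open>U\<close> because \<open>u * y\<close> is, and its idempotent
  power is the required \<open>g\<close>.\<close>

lemma factor_through_idempotent:
  assumes T: "finite T" "1 \<notin> T" "\<And>x y. x \<in> T \<Longrightarrow> y \<in> T \<Longrightarrow> x * y \<in> T"
    and U: "U \<subseteq> T" "\<And>x y. x \<in> U \<Longrightarrow> y \<in> U \<Longrightarrow> x * y \<in> U"
    and fact: "\<And>t. t \<in> T - U \<Longrightarrow> \<exists>x \<in> T - U. \<exists>u \<in> U. \<exists>y \<in> T - U. t = x * u * y \<and> u * y \<in> U"
    and t: "t \<in> T - U" and max: "\<And>z. z \<in> T - U \<Longrightarrow> J_le (insert 1 T) t z \<Longrightarrow> J_le (insert 1 T) z t"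
  shows "\<exists>x \<in> T - U. \<exists>g \<in> U. \<exists>a \<in> insert 1 U. g * g = g \<and> t = x * g * a \<and> J_le (insert 1 T) g t"
proof -
  let ?M = "insert 1 T" and ?U1 = "insert 1 U"
  have M: "finite_submonoid ?M" using T unfolding finite_submonoid_def by auto
  have U1: "x * y \<in> ?U1" if "x \<in> ?U1" "y \<in> ?U1" for x y using that U(2) by auto
  \<comment> \<open>Green's \<open>R\<close>-preorder relative to \<open>U\<close> with the identity
    adjoined.\<close>
  define le where "le x z \<longleftrightarrow> (\<exists>a \<in> ?U1. x = z * a)" for x z
  have "le x z" if "le x y" "le y z" for x y z
    using that U1 unfolding le_def by (metis mult.assoc)
  moreover have "le x x" for x unfolding le_def by force
  ultimately obtain m where m: "m \<in> T - U" "le t m" "\<And>z. z \<in> T - U \<Longrightarrow> le m z \<Longrightarrow> le z m"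
    using finite_preorder_has_maximal[of "T - U" t le] T(1) t by blast
  obtain a where a: "a \<in> ?U1" "t = m * a" using m(2) le_def by blast
  obtain x u y where x: "x \<in> T - U" "u \<in> U" "y \<in> T - U" "m = x * u * y" "u * y \<in> U"
    using fact[OF m(1)] by blast
  have "le m x" unfolding le_def using x by (auto simp: mult.assoc)
  then obtain s where s: "s \<in> ?U1" "x = m * s" using m(3)[OF x(1)] le_def by blast
  define v where "v = s * u * y"
  have v: "v \<in> U" using s(1) x(5) U(2) unfolding v_def by (auto simp: mult.assoc)
  have mv: "m * v = m" unfolding v_def by (metis mult.assoc s(2) x(4))
  obtain n where n: "v ^ Suc n * v ^ Suc n = v ^ Suc n"
    using idempotent_power[OF M, of v] v U(1) by blast
  let ?g = "v ^ Suc n"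
  have g: "?g \<in> U" using power_closed[OF U(2) v] .
  have mg: "m * v ^ k = m" for k
    by (induction k) (use mv in \<open>simp_all add: mult.assoc[symmetric]\<close>)
  \<comment> \<open>Both \<open>g\<close> and \<open>t\<close> contain the factor \<open>y\<close>,
    which lies outside \<open>U\<close>; the maximality of \<open>t\<close> brings \<open>y\<close>,
    and with it \<open>g\<close>, below \<open>t\<close>.\<close>
  have "J_le ?M ?g y"
  proof (rule J_leI)
    show "v ^ n * s * u \<in> ?M"
      using finite_submonoid_power[OF M, of v n] v s(1) x(2) U(1) M
      unfolding finite_submonoid_def by blast
    show "?g = v ^ n * s * u * y * 1"
      by (metis mult.assoc mult.right_neutral power_Suc2 v_def)
  qed simp
  moreover have "J_le ?M t y"
  proof (rule J_leI)
    show "x * u \<in> ?M" using x T(3) U(1) by auto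
    show "a \<in> ?M" using a U(1) by auto
    show "t = x * u * y * a" using a x by simp
  qed
  ultimately have "J_le ?M ?g t" using max[OF x(3)] J_le_trans[OF M] by blast
  moreover have "t = m * ?g * a" using a mg[of "Suc n"] by simp
  ultimately show ?thesis using m(1) g a(1) n by blast
qed

lemma opposite_monoid: "class.monoid_mult 1 (\<lambda>x y. y * x)"
  by unfold_locales (simp_all add: mult.assoc)

text \<open>The left-right dual, read off in the opposite monoid, which has the same
  \<open>J\<close>-preorder.\<close>

lemma factor_through_idempotent':
  assumes T: "finite T" "1 \<notin> T" "\<And>x y. x \<in> T \<Longrightarrow> y \<in> T \<Longrightarrow> x * y \<in> T"
    and U: "U \<subseteq> T" "\<And>x y. x \<in> U \<Longrightarrow> y \<in> U \<Longrightarrow> x * y \<in> U"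
    and fact: "\<And>t. t \<in> T - U \<Longrightarrow> \<exists>x \<in> T - U. \<exists>u \<in> U. \<exists>y \<in> T - U. t = x * u * y \<and> x * u \<in> U"
    and t: "t \<in> T - U" and max: "\<And>z. z \<in> T - U \<Longrightarrow> J_le (insert 1 T) t z \<Longrightarrow> J_le (insert 1 T) z t"
  shows "\<exists>y \<in> T - U. \<exists>g \<in> U. \<exists>a \<in> insert 1 U. g * g = g \<and> t = a * g * y \<and> J_le (insert 1 T) g t"
proof -
  interpret opp: monoid_mult 1 "\<lambda>x y. y * x" by (rule opposite_monoid)
  have J: "opp.J_le M x y \<longleftrightarrow> J_le M x y" for M x y
    unfolding J_le_def opp.J_le_def by (metis mult.assoc)
  have "\<exists>y \<in> T - U. \<exists>g \<in> U. \<exists>a \<in> insert 1 U. g * g = g \<and> t = a * (g * y) \<and> opp.J_le (insert 1 T) g t"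
  proof (rule opp.factor_through_idempotent[OF T(1,2) _ U(1) _ _ t])
    show "\<exists>x \<in> T - U. \<exists>u \<in> U. \<exists>y \<in> T - U. s = y * (u * x) \<and> y * u \<in> U" if "s \<in> T - U" for s
      using fact[OF that] by (metis mult.assoc)
  qed (use T(3) U(2) max J in auto)
  then show ?thesis by (simp add: J mult.assoc)
qed

text \<open>The hypothesis \<open>H\<close> is what the three identities have in common.\<close>

lemma no_proper_extension:
  assumes T: "finite T" "1 \<notin> T" "\<And>x y. x \<in> T \<Longrightarrow> y \<in> T \<Longrightarrow> x * y \<in> T"
    and U: "U \<subseteq> T" "\<And>x y. x \<in> U \<Longrightarrow> y \<in> U \<Longrightarrow> x * y \<in> U"
    and fact: "\<And>t. t \<in> T - U \<Longrightarrow> \<exists>x \<in> T - U. \<exists>u \<in> U. \<exists>y \<in> T - U. t = x * u * y \<and> u * y \<in> U"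
    and fact': "\<And>t. t \<in> T - U \<Longrightarrow> \<exists>x \<in> T - U. \<exists>u \<in> U. \<exists>y \<in> T - U. t = x * u * y \<and> x * u \<in> U"
    and H: "\<And>x e f. x \<in> U \<Longrightarrow> e \<in> U \<Longrightarrow> f \<in> U \<Longrightarrow> e * e = e \<Longrightarrow> f * f = f \<Longrightarrow>
      \<exists>n. (e * x * f) * (e * x * f) ^ Suc n = e * x * f \<or>
          (e * x * f) * (e * f) ^ Suc n = e * x * f \<or> (e * f) ^ Suc n * (e * x * f) = e * x * f"
  shows "U = T"
proof (rule ccontr)
  assume "U \<noteq> T"
  then obtain t where "t \<in> T - U" using U(1) by blast
  let ?M = "insert 1 T"
  have M: "finite_submonoid ?M" using T unfolding finite_submonoid_def by auto
  note Mcl = M[unfolded finite_submonoid_def]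
  note tr = J_le_trans[OF M]
  obtain d where d: "d \<in> T - U" and "J_le ?M t d"
    and dmax: "\<And>z. z \<in> T - U \<Longrightarrow> J_le ?M d z \<Longrightarrow> J_le ?M z d"
    using finite_preorder_has_maximal[of "T - U" t "J_le ?M"] T(1) \<open>t \<in> T - U\<close>
      J_le_refl[OF M] tr by blast
  obtain x u y where x: "x \<in> T - U" "u \<in> U" "y \<in> T - U" "d = x * u * y" "u * y \<in> U"
    using fact[OF d] by blast
  \<comment> \<open>As factors of \<open>d\<close> outside \<open>U\<close>, both \<open>x\<close>
    and \<open>y\<close> inherit its \<open>J\<close>-maximality, which the factorization lemmas
    require.\<close>
  have "J_le ?M d x"
    by (rule J_leI[of 1 _ "u * y"]) (use x U(1) in \<open>auto simp: mult.assoc\<close>)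
  then have xd: "J_le ?M x d" and xmax: "\<And>z. z \<in> T - U \<Longrightarrow> J_le ?M x z \<Longrightarrow> J_le ?M z x"
    using dmax x(1) tr by blast+
  have "J_le ?M d y"
    by (rule J_leI[of "x * u" _ 1]) (use x U(1) T(3) in \<open>auto simp: mult.assoc\<close>)
  then have yd: "J_le ?M y d" and ymax: "\<And>z. z \<in> T - U \<Longrightarrow> J_le ?M y z \<Longrightarrow> J_le ?M z y"
    using dmax x(3) tr by blast+
  obtain x' g a where x': "x' \<in> T - U" "g \<in> U" "a \<in> insert 1 U" "g * g = g" "x = x' * g * a"
      "J_le ?M g x"
    using factor_through_idempotent[OF T U fact x(1) xmax] by blast
  obtain y' k b where y': "y' \<in> T - U" "k \<in> U" "b \<in> insert 1 U" "k * k = k" "y = b * k * y'"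
      "J_le ?M k y"
    using factor_through_idempotent'[OF T U fact' x(3) ymax] by blast
  define w where "w = g * (a * u * b) * k"
  have aub: "a * u * b \<in> U" using x(2) x'(3) y'(3) U(2) by auto
  have wU: "w \<in> U" unfolding w_def using aub x'(2) y'(2) U(2) by blast
  have "w * y' = g * a * (u * y)" unfolding w_def y'(5) by (simp add: mult.assoc)
  then have wy: "w * y' \<in> U" using x'(2,3) x(5) U(2) by auto
  have gw: "g * w = w" and wk: "w * k = w"
    using x'(4) y'(4) unfolding w_def by (metis mult.assoc)+
  have "d = x' * w * y'" unfolding w_def x(4) x'(5) y'(5) by (simp add: mult.assoc)
  then have dw: "J_le ?M d w" using x'(1) y'(1) by (intro J_leI[of x' _ y']) auto
  have gw': "J_le ?M g w" and kw': "J_le ?M k w"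
    using dw x'(6) y'(6) xd yd tr by blast+
  have inM: "w \<in> ?M" "g \<in> ?M" "k \<in> ?M" using wU x'(2) y'(2) U(1) by auto
  have gk: "g * k \<in> ?M" using Mcl inM by blast
  \<comment> \<open>In each of the three cases the aim is that \<open>w\<close> is
    \<open>J\<close>-below \<open>k * w\<close>. As \<open>k\<close> is below \<open>w\<close>, this
    makes \<open>k * w\<close> a unit of the local monoid at \<open>k\<close>.\<close>
  obtain n where "w * w ^ Suc n = w \<or> w * (g * k) ^ Suc n = w \<or> (g * k) ^ Suc n * w = w"
    using H[OF aub x'(2) y'(2) x'(4) y'(4)] unfolding w_def by blast
  moreover have "J_le ?M w (k * w)" if "w * w ^ Suc n = w"
  proof (rule J_leI)
    show "w ^ Suc n \<in> ?M" using finite_submonoid_power[OF M inM(1)] .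
    show "w = w ^ Suc n * (k * w) * 1"
      using that wk by (metis mult.assoc mult.right_neutral power_Suc2 power_commutes)
  qed simp
  moreover have "J_le ?M w (k * w)" if "(g * k) ^ Suc n * w = w"
  proof (rule J_leI)
    show "(g * k) ^ n * g \<in> ?M" using finite_submonoid_power[OF M gk] Mcl inM by blast
    show "w = (g * k) ^ n * g * (k * w) * 1"
      using that by (metis mult.assoc mult.right_neutral power_Suc2)
  qed simp
  \<comment> \<open>Here the identity multiplies \<open>w\<close> on the right only, so the detour
    goes through \<open>g\<close>: it becomes a power of \<open>w * g\<close>, and
    \<open>w = g * w\<close> then contains \<open>w * w = w * (k * w)\<close>.\<close>
  moreover have "J_le ?M w (k * w)" if eq: "w * (g * k) ^ Suc n = w"
  proof -
    have "J_le ?M w (w * g)"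
    proof (rule J_leI[where p = 1])
      show "k * (g * k) ^ n \<in> ?M" using finite_submonoid_power[OF M gk] Mcl inM by blast
      show "w = 1 * (w * g) * (k * (g * k) ^ n)" using eq by (simp add: mult.assoc)
    qed simp
    then have "J_le ?M g (w * g)" using gw' tr by blast
    moreover have "w * g \<in> ?M" using Mcl inM by blast
    ultimately obtain j where j: "(w * g) ^ Suc j = g"
      using unit_power_of_J_le[OF M inM(2) _ x'(4)] gw x'(4) by (metis mult.assoc)
    show ?thesis
    proof (rule J_leI)
      show "(w * g) ^ j * w \<in> ?M"
        using finite_submonoid_power[OF M \<open>w * g \<in> ?M\<close>] Mcl inM by blast
      have "w = (w * g) ^ Suc j * w" using j gw by simp
      also have "\<dots> = (w * g) ^ j * w * (k * w)"
        by (metis gw mult.assoc power_Suc2 wk)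
      finally show "w = (w * g) ^ j * w * (k * w) * 1" by simp
    qed simp
  qed
  ultimately have "J_le ?M w (k * w)" by blast
  then have "J_le ?M k (k * w)" using kw' tr by blast
  moreover have "k * w \<in> ?M" using Mcl inM by blast
  ultimately obtain j where j: "(k * w) ^ Suc j = k"
    using unit_power_of_J_le[OF M inM(3) _ y'(4)] y'(4) wk by (metis mult.assoc)
  \<comment> \<open>\<open>(k * w) ^ j * k\<close> is a left inverse of \<open>w\<close> over
    \<open>k\<close>. It lies in \<open>U\<close> even for \<open>j = 0\<close>, because of the
    factor \<open>k\<close>, and it carries \<open>w * y'\<close> to \<open>k * y'\<close>.\<close>
  have "k * w \<in> U" using y'(2) wU U(2) by blast
  then have "(k * w) ^ j * k \<in> U"
    using power_closed[OF U(2)] y'(2) U(2) by (cases j) auto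
  then have "((k * w) ^ j * k) * (w * y') \<in> U" using wy U(2) by blast
  then have "k * y' \<in> U" using j by (metis mult.assoc power_Suc2)
  then have "y \<in> U" using y'(3) U(2) unfolding y'(5) by (auto simp: mult.assoc)
  then show False using x(3) by blast
qed

end

section \<open>Adjoining an identity\<close>

lemma semigroup_closed:
  "is_semigroup S \<Longrightarrow> x \<in> carrier S \<Longrightarrow> y \<in> carrier S \<Longrightarrow> x \<cdot>\<^bsub>S\<^esub> y \<in> carrier S"
  by (auto simp: is_semigroup_def)

lemma semigroup_assoc:
  "is_semigroup S \<Longrightarrow> x \<in> carrier S \<Longrightarrow> y \<in> carrier S \<Longrightarrow> z \<in> carrier S \<Longrightarrow>
    x \<cdot>\<^bsub>S\<^esub> y \<cdot>\<^bsub>S\<^esub> z = x \<cdot>\<^bsub>S\<^esub> (y \<cdot>\<^bsub>S\<^esub> z)"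
  by (auto simp: is_semigroup_def)

text \<open>The identity is \<open>None\<close>. Products involving values outside the carrier stay outside
  the carrier, which makes the operation associative on the whole type.\<close>

fun with_one :: "'a semigrp \<Rightarrow> 'a option \<Rightarrow> 'a option \<Rightarrow> 'a option" where
  "with_one S None y = y"
| "with_one S x None = x"
| "with_one S (Some a) (Some b) =
    (if a \<in> carrier S \<and> b \<in> carrier S then Some (a \<cdot>\<^bsub>S\<^esub> b) else Some (SOME z. z \<notin> carrier S))"

lemma with_one_None [simp]: "with_one S x None = x"
  by (cases x) auto

lemma junk_not_in_carrier: "a \<notin> carrier S \<Longrightarrow> (SOME z. z \<notin> carrier S) \<notin> carrier S"
  by (rule someI)

lemma monoid_with_one:
  assumes "is_semigroup S"
  shows "class.monoid_mult None (with_one S)"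
proof
  fix x y z
  show "with_one S (with_one S x y) z = with_one S x (with_one S y z)"
  proof (cases "x = None \<or> y = None \<or> z = None")
    case False
    then obtain a b c where abc: "x = Some a" "y = Some b" "z = Some c" by auto
    show ?thesis
    proof (cases "a \<in> carrier S \<and> b \<in> carrier S \<and> c \<in> carrier S")
      case True
      then show ?thesis
        using semigroup_assoc[OF assms] semigroup_closed[OF assms] unfolding abc by simp
    next
      case False
      define j where "j = (SOME z. z \<notin> carrier S)"
      obtain z where "z \<notin> carrier S" using False by blast
      then have "j \<notin> carrier S" unfolding j_def by (rule junk_not_in_carrier)
      moreover have "with_one S (Some p) (Some q) =
          (if p \<in> carrier S \<and> q \<in> carrier S then Some (p \<cdot>\<^bsub>S\<^esub> q) else Some j)" for p q
        by (simp add: j_def)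
      ultimately show ?thesis using False unfolding abc by (simp del: with_one.simps)
    qed
  qed auto
qed auto

text \<open>The junk value is outside the carrier and absorbs, so a product with a value in the
  carrier has both factors in the adjoined monoid.\<close>

lemma with_one_eq_SomeD:
  assumes "is_semigroup S" "with_one S x y = Some a" "a \<in> carrier S"
  shows "x \<in> insert None (Some ` carrier S)" "y \<in> insert None (Some ` carrier S)"
  using assms(2,3) junk_not_in_carrier[of _ S] by (cases x; cases y; auto split: if_splits)+

lemma with_one_image_closed:
  assumes "is_semigroup S" "x \<in> Some ` carrier S" "y \<in> Some ` carrier S"
  shows "with_one S x y \<in> Some ` carrier S"
  using assms semigroup_closed[OF assms(1)] by auto

lemma finite_submonoid_with_one:
  assumes "finite_semigroup S"
  shows "monoid_mult.finite_submonoid None (with_one S) (insert None (Some ` carrier S))"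
proof -
  interpret monoid_mult None "with_one S"
    using monoid_with_one assms unfolding finite_semigroup_def by blast
  show ?thesis
    using assms with_one_image_closed[of S] unfolding finite_submonoid_def finite_semigroup_def
    by auto
qed

section \<open>Powers and \<open>omega\<close> in terms of the adjoined monoid\<close>

lemma power_Suc_closed:
  "is_semigroup S \<Longrightarrow> s \<in> carrier S \<Longrightarrow> power_Suc S s n \<in> carrier S"
  by (induction n) (auto intro: semigroup_closed)

lemma Some_power_Suc:
  assumes "is_semigroup S" "s \<in> carrier S"
  shows "Some (power_Suc S s n) = power.power None (with_one S) (Some s) (Suc n)"
proof -
  interpret monoid_mult None "with_one S" by (rule monoid_with_one[OF assms(1)])
  show ?thesis
  proof (induction n)
    case (Suc n)
    have "Some (power_Suc S s (Suc n)) = with_one S (Some (power_Suc S s n)) (Some s)"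
      using power_Suc_closed[OF assms] assms(2) by simp
    also have "\<dots> = power (Some s) (Suc (Suc n))" unfolding Suc power_Suc2[of _ "Suc n"] ..
    finally show ?case .
  qed simp
qed

lemma finite_semigroup_is_semigroup: "finite_semigroup S \<Longrightarrow> is_semigroup S"
  by (simp add: finite_semigroup_def)

lemma idempotent_power_Suc:
  assumes "finite_semigroup S" "s \<in> carrier S"
  shows "\<exists>n. idempotent S (power_Suc S s n)"
proof -
  note S = finite_semigroup_is_semigroup[OF assms(1)]
  interpret monoid_mult None "with_one S" by (rule monoid_with_one[OF S])
  obtain n where "with_one S (Some (power_Suc S s n)) (Some (power_Suc S s n))
      = Some (power_Suc S s n)"
    using idempotent_power[OF finite_submonoid_with_one[OF assms(1)], of "Some s"] assms(2)
    unfolding Some_power_Suc[OF S assms(2)] by blast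
  then show ?thesis
    using power_Suc_closed[OF S assms(2)] unfolding idempotent_def by auto
qed

lemma idempotent_power_Suc_unique:
  assumes S: "is_semigroup S" "s \<in> carrier S"
    and "idempotent S (power_Suc S s m)" "idempotent S (power_Suc S s n)"
  shows "power_Suc S s m = power_Suc S s n"
proof -
  interpret monoid_mult None "with_one S" by (rule monoid_with_one[OF S(1)])
  have "with_one S (Some (power_Suc S s k)) (Some (power_Suc S s k)) = Some (power_Suc S s k)"
    if "idempotent S (power_Suc S s k)" for k
    using that by (simp add: idempotent_def)
  note idem = this[unfolded Some_power_Suc[OF S]]
  let ?p = "\<lambda>k. power (Some s) (Suc k)"
  have eq: "with_one S (?p m) (?p n) = ?p m" "with_one S (?p m) (?p n) = ?p n"
    using fixed_by_idempotent_power[of "?p m" "Some s" m n] idem assms(3,4)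
      fixed_by_idempotent_power'[of "Some s" n "?p n" m] by blast+
  then show ?thesis
    using Some_power_Suc[OF S] by (metis option.inject)
qed

lemma omega_power_Suc:
  assumes "is_semigroup S" "s \<in> carrier S" "idempotent S (power_Suc S s n)"
  shows "omega S s = power_Suc S s n"
  unfolding omega_def
  by (rule the_equality) (use assms idempotent_power_Suc_unique[OF assms(1,2)] in auto)

lemma omega_in_carrier: "finite_semigroup S \<Longrightarrow> s \<in> carrier S \<Longrightarrow> omega S s \<in> carrier S"
  using idempotent_power_Suc[of S s] omega_power_Suc[of S s] power_Suc_closed[of S s]
    finite_semigroup_is_semigroup[of S] by auto

lemma omega_eq_power:
  assumes "finite_semigroup S" "s \<in> carrier S"
  shows "\<exists>n. Some (omega S s) = power.power None (with_one S) (Some s) (Suc n) \<and>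
    idempotent S (omega S s)"
proof -
  note S = finite_semigroup_is_semigroup[OF assms(1)]
  obtain n where n: "idempotent S (power_Suc S s n)" using idempotent_power_Suc[OF assms] by blast
  show ?thesis
    using n omega_power_Suc[OF S assms(2) n] Some_power_Suc[OF S assms(2), of n] by auto
qed

text \<open>\<open>omega S c\<close> is the idempotent power of \<open>c\<close> and fixes whatever
  some positive power of \<open>c\<close> fixes. Contrapositively, the failure of an identity stated
  with \<open>omega\<close> excludes all positive powers at once.\<close>

lemma omega_absorbs_right:
  assumes S: "finite_semigroup S" "c \<in> carrier S" "a \<in> carrier S"
    and "with_one S (Some a) (power.power None (with_one S) (Some c) (Suc n)) = Some a"
  shows "a \<cdot>\<^bsub>S\<^esub> omega S c = a"
proof -
  interpret monoid_mult None "with_one S"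
    by (rule monoid_with_one[OF finite_semigroup_is_semigroup[OF S(1)]])
  obtain m where m: "Some (omega S c) = power (Some c) (Suc m)" "idempotent S (omega S c)"
    using omega_eq_power[OF S(1,2)] by blast
  then have "with_one S (power (Some c) (Suc m)) (power (Some c) (Suc m)) = power (Some c) (Suc m)"
    unfolding m(1)[symmetric] by (simp add: idempotent_def)
  then have "with_one S (Some a) (Some (omega S c)) = Some a"
    using fixed_by_idempotent_power[OF assms(4)] m(1) by simp
  then show ?thesis using S omega_in_carrier[OF S(1,2)] by simp
qed

lemma omega_absorbs_left:
  assumes S: "finite_semigroup S" "c \<in> carrier S" "a \<in> carrier S"
    and "with_one S (power.power None (with_one S) (Some c) (Suc n)) (Some a) = Some a"
  shows "omega S c \<cdot>\<^bsub>S\<^esub> a = a"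
proof -
  interpret monoid_mult None "with_one S"
    by (rule monoid_with_one[OF finite_semigroup_is_semigroup[OF S(1)]])
  obtain m where m: "Some (omega S c) = power (Some c) (Suc m)" "idempotent S (omega S c)"
    using omega_eq_power[OF S(1,2)] by blast
  then have "with_one S (power (Some c) (Suc m)) (power (Some c) (Suc m)) = power (Some c) (Suc m)"
    unfolding m(1)[symmetric] by (simp add: idempotent_def)
  then have "with_one S (Some (omega S c)) (Some a) = Some a"
    using fixed_by_idempotent_power'[OF assms(4)] m(1) by simp
  then show ?thesis using S omega_in_carrier[OF S(1,2)] by simp
qed

section \<open>Dominions and saturation\<close>

text \<open>The map sending \<open>d\<close> to the function \<open>(x, y) \<mapsto> g (x d) y - g x (d y)\<close>, with values
  modulo 2, is a derivation into a bimodule of functions that vanishes exactly where \<open>g\<close> is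
  balanced. So \<open>d \<mapsto> (d, 0)\<close> and \<open>d \<mapsto> (d, \<delta> d)\<close> are homomorphisms that agree on \<open>A\<close>. This
  gives the half of Isbell's zigzag theorem that is needed.\<close>

lemma dominion_balanced:
  fixes T :: "'a semigrp" and g :: "'a option \<Rightarrow> 'a option \<Rightarrow> bool"
  assumes inf: "infinite (UNIV :: 'r set)" and T: "finite_semigroup T"
    and A: "A \<subseteq> carrier T"
    and g: "\<And>a x y. a \<in> A \<Longrightarrow> g (with_one T x (Some a)) y = g x (with_one T (Some a) y)"
    and d: "d \<in> dominion TYPE('r) A T"
  shows "g (with_one T x (Some d)) y = g x (with_one T (Some d) y)"
proof -
  note sT = finite_semigroup_is_semigroup[OF T]
  interpret monoid_mult None "with_one T" by (rule monoid_with_one[OF sT])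
  \<comment> \<open>The square-zero extension of \<open>T\<close> by the bimodule, with \<noteq> on
    truth values as addition modulo 2. In the product of \<gamma> s and \<gamma> t the value of
    \<open>g\<close> at \<open>x s\<close> and \<open>t y\<close> occurs twice and cancels, which
    makes \<gamma> multiplicative.\<close>
  define R :: "('a \<times> ('a option \<Rightarrow> 'a option \<Rightarrow> bool)) semigrp" where
    "R = \<lparr>carrier = carrier T \<times> UNIV, mult = (\<lambda>(s, \<phi>) (t, \<psi>). (s \<cdot>\<^bsub>T\<^esub> t,
      \<lambda>x y. \<phi> x (with_one T (Some t) y) \<noteq> \<psi> (with_one T x (Some s)) y))\<rparr>"
  have SomeM: "Some (s \<cdot>\<^bsub>T\<^esub> t) = with_one T (Some s) (Some t)"
    if "s \<in> carrier T" "t \<in> carrier T" for s t using that by simp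
  have "is_semigroup R"
    unfolding is_semigroup_def
  proof (intro conjI ballI)
    show "carrier R \<noteq> {}" using sT by (simp add: R_def is_semigroup_def)
    fix p q r assume pqr: "p \<in> carrier R" "q \<in> carrier R" "r \<in> carrier R"
    then show "p \<cdot>\<^bsub>R\<^esub> q \<in> carrier R" using semigroup_closed[OF sT] by (auto simp: R_def)
    show "p \<cdot>\<^bsub>R\<^esub> q \<cdot>\<^bsub>R\<^esub> r = p \<cdot>\<^bsub>R\<^esub> (q \<cdot>\<^bsub>R\<^esub> r)"
      using pqr semigroup_assoc[OF sT]
      by (auto simp: R_def SomeM mult.assoc fun_eq_iff simp del: with_one.simps)
  qed
  define \<gamma> where "\<gamma> s = (s, \<lambda>x y. g (with_one T x (Some s)) y \<noteq> g x (with_one T (Some s) y))" for s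
  have "(\<lambda>s. (s, \<lambda>x y. False)) \<in> shom T R" by (auto simp: shom_def R_def)
  moreover have "\<gamma> \<in> shom T R"
    unfolding shom_def
    by (auto simp: \<gamma>_def R_def SomeM mult.assoc fun_eq_iff simp del: with_one.simps)
  moreover have "\<forall>a \<in> A. (a, \<lambda>x y. False) = \<gamma> a" using g by (auto simp: \<gamma>_def)
  \<comment> \<open>\<open>R\<close> has an element type of its own, so the dominion is moved from
    the universe \<open>'r\<close> to that type.\<close>
  moreover have "\<forall>\<beta> \<in> shom T R. \<forall>\<gamma> \<in> shom T R. (\<forall>a \<in> A. \<beta> a = \<gamma> a) \<longrightarrow> \<beta> d = \<gamma> d"
    using subsetD[OF dominion_universe[OF inf T] d] \<open>is_semigroup R\<close> by (auto simp: dominion_def)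
  ultimately have "(d, \<lambda>x y. False) = \<gamma> d" by meson
  then show ?thesis by (auto simp: \<gamma>_def fun_eq_iff)
qed

lemma saturatedI:
  fixes S T :: "'a semigrp"
  assumes inf: "infinite (UNIV :: 'r set)" and T: "finite_semigroup T" and S: "subsemigroup S T"
    and dom: "dominion TYPE('r) (carrier S) T = carrier T"
    and H: "\<And>x e f. x \<in> carrier S \<Longrightarrow> idempotent S e \<Longrightarrow> idempotent S f \<Longrightarrow>
      let w = e \<cdot>\<^bsub>S\<^esub> x \<cdot>\<^bsub>S\<^esub> f in
      omega_plus_1 S w = w \<or> w \<cdot>\<^bsub>S\<^esub> omega S (e \<cdot>\<^bsub>S\<^esub> f) = w \<or> omega S (e \<cdot>\<^bsub>S\<^esub> f) \<cdot>\<^bsub>S\<^esub> w = w"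
  shows "carrier S = carrier T"
proof -
  note sT = finite_semigroup_is_semigroup[OF T]
  have sS: "is_semigroup S" and sub: "carrier S \<subseteq> carrier T"
    and mult: "\<And>x y. x \<in> carrier S \<Longrightarrow> y \<in> carrier S \<Longrightarrow> x \<cdot>\<^bsub>S\<^esub> y = x \<cdot>\<^bsub>T\<^esub> y"
    using S by (auto simp: subsemigroup_def)
  have fS: "finite_semigroup S"
    using sS sub T finite_subset unfolding finite_semigroup_def by blast
  interpret monoid_mult None "with_one T" by (rule monoid_with_one[OF sT])
  let ?T = "Some ` carrier T" and ?U = "Some ` carrier S"
  have Ucl: "with_one T x y \<in> ?U" if "x \<in> ?U" "y \<in> ?U" for x y
    using that sub mult semigroup_closed[OF sS] by auto
  have bal: "g (with_one T (Some d) None) None = g None (with_one T (Some d) None)"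
    if "d \<in> carrier T" "\<And>a x y. a \<in> carrier S \<Longrightarrow>
      g (with_one T x (Some a)) y = g x (with_one T (Some a) y)"
    for d and g :: "'a option \<Rightarrow> 'a option \<Rightarrow> bool"
    using dominion_balanced[OF inf T sub that(2), of d None None] that(1) dom by simp
  \<comment> \<open>A priori \<open>x\<close> and \<open>y\<close> could be junk; as factors of an
    element of \<open>T\<close> they are not.\<close>
  have nonU: "z \<in> ?T - ?U" if h: "with_one T (with_one T x u) y = t" "t \<in> ?T - ?U" "u \<in> ?U"
    "z \<notin> ?U" "z \<noteq> None" "z = x \<or> z = y" for x u y t z
  proof -
    obtain a where a: "t = Some a" "a \<in> carrier T" using h(2) by blast
    have "x \<in> insert None ?T \<and> y \<in> insert None ?T"
      using with_one_eq_SomeD[OF sT, of "with_one T x u" y a]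
        with_one_eq_SomeD[OF sT, of x "with_one T u y" a] h(1) a
      by (simp add: mult.assoc)
    then show ?thesis using h(4-6) by blast
  qed
  have fact: "\<exists>x \<in> ?T - ?U. \<exists>u \<in> ?U. \<exists>y \<in> ?T - ?U.
      t = with_one T (with_one T x u) y \<and> with_one T u y \<in> ?U" if t: "t \<in> ?T - ?U" for t
  proof -
    obtain d where d: "t = Some d" "d \<in> carrier T" "d \<notin> carrier S" using t by auto
    \<comment> \<open>This holds at \<open>(d, None)\<close> and fails at \<open>(None, d)\<close>,
      so it is unbalanced at some \<open>a\<close> of \<open>S\<close>. If \<open>y\<close> were in
      \<open>S\<close> or the identity, then so would be the product of \<open>a\<close> and
      \<open>y\<close>, and both sides would agree. Hence \<open>y\<close> is outside, and the true
      side is the one with \<open>a\<close> moved to the right.\<close>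
    define g where "g x y \<longleftrightarrow> with_one T x y = t \<and> y \<in> insert None ?U" for x y
    have "g (Some d) None" "\<not> g None (Some d)" using d by (auto simp: g_def)
    then obtain a x y where a: "a \<in> carrier S"
      and ne: "g (with_one T x (Some a)) y \<noteq> g x (with_one T (Some a) y)"
      using bal[of d g] d(2) by auto
    have y: "y \<notin> insert None ?U"
      using ne Ucl[of "Some a" y] a by (auto simp: g_def mult.assoc)
    then have *: "with_one T (with_one T x (Some a)) y = t" "with_one T (Some a) y \<in> insert None ?U"
      using ne by (auto simp: g_def mult.assoc)
    have u: "with_one T (Some a) y \<in> ?U" using *(2) y by (cases y) auto
    then have "x \<notin> insert None ?U"
      using *(1) Ucl t by (auto simp: mult.assoc)
    then have "x \<in> ?T - ?U" "y \<in> ?T - ?U"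
      using nonU[OF *(1) t, of x] nonU[OF *(1) t, of y] y a by auto
    then show ?thesis using u a *(1) by (metis imageI)
  qed
  have fact': "\<exists>x \<in> ?T - ?U. \<exists>u \<in> ?U. \<exists>y \<in> ?T - ?U.
      t = with_one T (with_one T x u) y \<and> with_one T x u \<in> ?U" if t: "t \<in> ?T - ?U" for t
  proof -
    obtain d where d: "t = Some d" "d \<in> carrier T" "d \<notin> carrier S" using t by auto
    \<comment> \<open>The mirror image, with the condition on the left factor.\<close>
    define g where "g x y \<longleftrightarrow> with_one T x y = t \<and> x \<in> insert None ?U" for x y
    have "\<not> g (Some d) None" "g None (Some d)" using d by (auto simp: g_def)
    then obtain a x y where a: "a \<in> carrier S"
      and ne: "g (with_one T x (Some a)) y \<noteq> g x (with_one T (Some a) y)"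
      using bal[of d g] d(2) by auto
    have x: "x \<notin> insert None ?U"
      using ne Ucl[of x "Some a"] a by (auto simp: g_def mult.assoc)
    then have *: "with_one T (with_one T x (Some a)) y = t" "with_one T x (Some a) \<in> insert None ?U"
      using ne by (auto simp: g_def mult.assoc)
    have u: "with_one T x (Some a) \<in> ?U" using *(2) x by (cases x) auto
    then have "y \<notin> insert None ?U"
      using *(1) Ucl t by auto
    then have "x \<in> ?T - ?U" "y \<in> ?T - ?U"
      using nonU[OF *(1) t, of x] nonU[OF *(1) t, of y] x a by auto
    then show ?thesis using u a *(1) by (metis imageI)
  qed
  have "?U = ?T"
  proof (rule no_proper_extension[OF _ _ _ _ Ucl fact fact'])
    show "finite ?T" using T by (simp add: finite_semigroup_def)
    show "with_one T x y \<in> ?T" if "x \<in> ?T" "y \<in> ?T" for x y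
      using with_one_image_closed[OF sT that] .
    show "?U \<subseteq> ?T" using sub by blast
    fix X E F
    assume X: "X \<in> ?U" "E \<in> ?U" "F \<in> ?U" and idem: "with_one T E E = E" "with_one T F F = F"
    then obtain x e f where x: "X = Some x" "E = Some e" "F = Some f"
      "x \<in> carrier S" "e \<in> carrier S" "f \<in> carrier S" by blast
    have ef: "idempotent S e" "idempotent S f"
      using idem x sub mult unfolding idempotent_def by auto
    let ?w = "e \<cdot>\<^bsub>S\<^esub> x \<cdot>\<^bsub>S\<^esub> f" and ?c = "e \<cdot>\<^bsub>S\<^esub> f"
    have wc: "?w \<in> carrier S" "?c \<in> carrier S" using x semigroup_closed[OF sS] by blast+
    have tow: "with_one T (Some p) (Some q) = Some (p \<cdot>\<^bsub>S\<^esub> q)"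
      if "p \<in> carrier S" "q \<in> carrier S" for p q using that sub mult by auto
    have w: "with_one T (with_one T E X) F = Some ?w" "with_one T E F = Some ?c"
      using x semigroup_closed[OF sS] by (simp_all add: tow del: with_one.simps)
    have pow: "Some (power_Suc S s n) = power (Some s) (Suc n)" if "s \<in> carrier S" for s n
    proof (induction n)
      case (Suc n)
      have "Some (power_Suc S s (Suc n)) = with_one T (Some (power_Suc S s n)) (Some s)"
        using tow power_Suc_closed[OF sS that] that by simp
      also have "\<dots> = power (Some s) (Suc (Suc n))" unfolding Suc power_Suc2[of _ "Suc n"] ..
      finally show ?case .
    qed simp
    have om: "\<exists>n. Some (omega S s) = power (Some s) (Suc n)" if s: "s \<in> carrier S" for s
    proof -
      obtain n where n: "idempotent S (power_Suc S s n)" using idempotent_power_Suc[OF fS s] by blast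
      show ?thesis using omega_power_Suc[OF sS s n] pow[OF s, of n] by auto
    qed
    note H' = H[OF x(4) ef, unfolded Let_def omega_plus_1_def]
    have omc: "omega S ?c \<in> carrier S" "omega S ?w \<in> carrier S"
      using omega_in_carrier[OF fS] wc by blast+
    have "with_one T (Some ?w) (Some (omega S ?c)) = Some ?w \<or>
        with_one T (Some (omega S ?c)) (Some ?w) = Some ?w \<or>
        with_one T (Some (omega S ?w)) (Some ?w) = Some ?w"
      using H' wc omc by (auto simp: tow simp del: with_one.simps)
    moreover obtain m n where "Some (omega S ?w) = power (Some ?w) (Suc m)"
      "Some (omega S ?c) = power (Some ?c) (Suc n)" using om wc by blast
    ultimately have "\<exists>n. with_one T (Some ?w) (power (Some ?w) (Suc n)) = Some ?w \<or>
        with_one T (Some ?w) (power (Some ?c) (Suc n)) = Some ?w \<or>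
        with_one T (power (Some ?c) (Suc n)) (Some ?w) = Some ?w"
      using power_commutes[of "Some ?w" "Suc m"] by auto
    then show "\<exists>n. with_one T (with_one T (with_one T E X) F)
          (power (with_one T (with_one T E X) F) (Suc n)) = with_one T (with_one T E X) F \<or>
        with_one T (with_one T (with_one T E X) F) (power (with_one T E F) (Suc n))
          = with_one T (with_one T E X) F \<or>
        with_one T (power (with_one T E F) (Suc n)) (with_one T (with_one T E X) F)
          = with_one T (with_one T E X) F"
      unfolding w by blast
  qed auto
  then show ?thesis by (simp add: inj_image_eq_iff)
qed

lemma F_saturated_if_subset:
  fixes u :: "'r itself"
  assumes inf: "infinite (UNIV :: 'r set)" and "C \<subseteq> V1 \<or> C \<subseteq> V2 \<or> C \<subseteq> V3"
  shows "F_saturated u C"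
  unfolding F_saturated_def F_saturated_semigroup_def
proof (intro ballI conjI allI impI)
  fix S assume "S \<in> C"
  then have S: "S \<in> V1 \<union> V2 \<union> V3" using assms(2) by blast
  then show "finite_semigroup S" by (auto simp: V1_def V2_def V3_def)
  fix T :: "nat semigrp"
  assume T: "finite_semigroup T \<and> subsemigroup S T \<and> carrier S \<noteq> carrier T"
  show "dominion u (carrier S) T \<noteq> carrier T"
  proof
    assume "dominion u (carrier S) T = carrier T"
    then have dom: "dominion TYPE('r) (carrier S) T = carrier T" by (simp add: dominion_def)
    have "carrier S = carrier T"
      by (rule saturatedI[OF inf _ _ dom])
        (use S T in \<open>auto simp: V1_def V2_def V3_def Let_def\<close>)
    then show False using T by blast
  qed
qed

section \<open>Homomorphisms and pseudovarieties\<close>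

lemma shom_closed: "h \<in> shom S T \<Longrightarrow> x \<in> carrier S \<Longrightarrow> h x \<in> carrier T"
  by (simp add: shom_def)

lemma shom_mult:
  "h \<in> shom S T \<Longrightarrow> x \<in> carrier S \<Longrightarrow> y \<in> carrier S \<Longrightarrow> h (x \<cdot>\<^bsub>S\<^esub> y) = h x \<cdot>\<^bsub>T\<^esub> h y"
  by (simp add: shom_def)

lemma shom_comp: "g \<in> shom S T \<Longrightarrow> h \<in> shom T R \<Longrightarrow> h \<circ> g \<in> shom S R"
  by (simp add: shom_def)

lemma shom_image_semigroup:
  assumes "is_semigroup S" "h \<in> shom S T"
  shows "is_semigroup \<lparr>carrier = h ` carrier S, mult = mult T\<rparr>"
  using assms(1) semigroup_closed[OF assms(1)] semigroup_assoc[OF assms(1)]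
  by (auto simp: is_semigroup_def shom_mult[OF assms(2), symmetric])

lemma shom_inv_into:
  assumes S: "is_semigroup S" and h: "h \<in> shom S T" "bij_betw h (carrier S) (carrier T)"
  shows "inv_into (carrier S) h \<in> shom T S"
  unfolding shom_def
proof (intro CollectI conjI ballI)
  have inj: "inj_on h (carrier S)" and im: "carrier T = h ` carrier S"
    using h(2) by (auto simp: bij_betw_def)
  fix x y assume "x \<in> carrier T" "y \<in> carrier T"
  then obtain a b where ab: "a \<in> carrier S" "b \<in> carrier S" "x = h a" "y = h b"
    unfolding im by blast
  then show "inv_into (carrier S) h x \<in> carrier S" using inj by simp
  show "inv_into (carrier S) h (x \<cdot>\<^bsub>T\<^esub> y)
      = inv_into (carrier S) h x \<cdot>\<^bsub>S\<^esub> inv_into (carrier S) h y"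
    using ab inj semigroup_closed[OF S] by (simp add: shom_mult[OF h(1), symmetric])
qed

section \<open>Copies of finite semigroups on \<open>nat\<close>\<close>

definition nat_copy :: "('a \<Rightarrow> nat) \<Rightarrow> 'a semigrp \<Rightarrow> nat semigrp" where
  "nat_copy f S = \<lparr>carrier = f ` carrier S,
    mult = (\<lambda>x y. f (inv_into (carrier S) f x \<cdot>\<^bsub>S\<^esub> inv_into (carrier S) f y))\<rparr>"

lemma nat_copy_simps:
  assumes "inj_on f (carrier S)"
  shows "carrier (nat_copy f S) = f ` carrier S"
    and "x \<in> carrier S \<Longrightarrow> y \<in> carrier S \<Longrightarrow> f x \<cdot>\<^bsub>nat_copy f S\<^esub> f y = f (x \<cdot>\<^bsub>S\<^esub> y)"
  using assms by (simp_all add: nat_copy_def)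

lemma nat_copy_shom:
  assumes "inj_on f (carrier S)"
  shows "f \<in> shom S (nat_copy f S)"
  by (simp add: shom_def nat_copy_simps[OF assms])

lemma nat_copy_semigroup:
  assumes "inj_on f (carrier S)" "finite_semigroup S"
  shows "finite_semigroup (nat_copy f S)"
proof -
  have S: "is_semigroup S" using assms(2) by (simp add: finite_semigroup_def)
  show ?thesis
    using assms semigroup_closed[OF S] semigroup_assoc[OF S]
    by (auto simp: finite_semigroup_def is_semigroup_def nat_copy_simps[OF assms(1)])
qed

lemma finite_semigroup_nat_inj:
  assumes "finite_semigroup S"
  obtains f :: "'a \<Rightarrow> nat" where "inj_on f (carrier S)"
  using assms finite_imp_inj_to_nat_seg[of "carrier S"] unfolding finite_semigroup_def by blast

section \<open>Closure properties of pseudovarieties\<close>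

context
  fixes V :: "nat semigrp set"
  assumes V: "pseudovariety V"
begin

lemma pseudovariety_finite: "S \<in> V \<Longrightarrow> finite_semigroup S"
  using V unfolding pseudovariety_def finite_semigroups_def by blast

lemma pseudovariety_image:
  "S \<in> V \<Longrightarrow> finite_semigroup T \<Longrightarrow> h \<in> shom S T \<Longrightarrow> h ` carrier S = carrier T \<Longrightarrow> T \<in> V"
  using V unfolding pseudovariety_def by blast

lemma pseudovariety_sub: "S \<in> V \<Longrightarrow> subsemigroup T S \<Longrightarrow> T \<in> V"
  using V unfolding pseudovariety_def by blast

lemma pseudovariety_product:
  fixes F :: "nat \<Rightarrow> nat semigrp"
  shows "(\<And>i. i < n \<Longrightarrow> F i \<in> V) \<Longrightarrow> belongs_to (product_semigroup {..<n} F) V"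
  using V unfolding pseudovariety_def by blast

lemma belongs_to_iff_mem: "finite_semigroup S \<Longrightarrow> belongs_to S V \<longleftrightarrow> S \<in> V"
proof
  assume S: "finite_semigroup S" "belongs_to S V"
  then obtain T h where T: "T \<in> V" "h \<in> shom S T" "bij_betw h (carrier S) (carrier T)"
    unfolding belongs_to_def isomorphic_def by blast
  have "inv_into (carrier S) h \<in> shom T S"
    using shom_inv_into[OF _ T(2,3)] S(1) by (simp add: finite_semigroup_def)
  then show "S \<in> V"
    using pseudovariety_image[OF T(1) S(1)] bij_betw_inv_into[OF T(3)] unfolding bij_betw_def by blast
next
  assume "S \<in> V"
  then show "belongs_to S V"
    unfolding belongs_to_def isomorphic_def
    by (intro bexI[of _ S] bexI[of _ id]) (auto simp: shom_def)
qed

lemma belongs_to_image: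
  assumes "belongs_to S V" "finite_semigroup T" "h \<in> shom S T" "h ` carrier S = carrier T"
    and S: "is_semigroup S"
  shows "belongs_to T V"
proof -
  obtain R g where R: "R \<in> V" "g \<in> shom S R" "bij_betw g (carrier S) (carrier R)"
    using assms(1) unfolding belongs_to_def isomorphic_def by blast
  have inv: "inv_into (carrier S) g \<in> shom R S"
    by (rule shom_inv_into[OF S R(2,3)])
  obtain f :: "'b \<Rightarrow> nat" where f: "inj_on f (carrier T)"
    using finite_semigroup_nat_inj[OF assms(2)] .
  have "f \<circ> (h \<circ> inv_into (carrier S) g) \<in> shom R (nat_copy f T)"
    by (intro shom_comp[OF shom_comp[OF inv assms(3)] nat_copy_shom[OF f]])
  moreover have "(f \<circ> (h \<circ> inv_into (carrier S) g)) ` carrier R = carrier (nat_copy f T)"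
    using assms(4) bij_betw_imp_surj_on[OF bij_betw_inv_into[OF R(3)]]
    by (simp only: image_comp[symmetric] nat_copy_simps[OF f])
  ultimately have "nat_copy f T \<in> V"
    using pseudovariety_image[OF R(1) nat_copy_semigroup[OF f assms(2)]] by blast
  then show ?thesis
    unfolding belongs_to_def isomorphic_def
    using nat_copy_shom[OF f] f
    by (intro bexI[of _ "nat_copy f T"] bexI[of _ f]) (auto simp: bij_betw_def nat_copy_simps[OF f])
qed

text \<open>Finitely many homomorphisms suffice to separate the points of \<open>X\<close>, which then embeds
  into a finite product of members of \<open>V\<close>.\<close>

lemma belongs_to_if_separated:
  fixes X :: "'a semigrp"
  assumes X: "finite_semigroup X"
    and sep: "\<And>x y. x \<in> carrier X \<Longrightarrow> y \<in> carrier X \<Longrightarrow> x \<noteq> y \<Longrightarrow> \<exists>Q \<in> V. \<exists>h \<in> shom X Q. h x \<noteq> h y"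
  shows "belongs_to X V"
proof -
  let ?D = "{p \<in> carrier X \<times> carrier X. fst p \<noteq> snd p}"
  have "\<forall>p \<in> ?D. \<exists>q. fst q \<in> V \<and> snd q \<in> shom X (fst q) \<and> snd q (fst p) \<noteq> snd q (snd p)"
  proof
    fix p assume "p \<in> ?D"
    then obtain Q h where "Q \<in> V" "h \<in> shom X Q" "h (fst p) \<noteq> h (snd p)"
      using sep[of "fst p" "snd p"] by (auto simp: mem_Times_iff)
    then show "\<exists>q. fst q \<in> V \<and> snd q \<in> shom X (fst q) \<and> snd q (fst p) \<noteq> snd q (snd p)"
      by (intro exI[of _ "(Q, h)"]) simp
  qed
  from bchoice[OF this] obtain q where "\<forall>p \<in> ?D. fst (q p) \<in> V \<and>
      snd (q p) \<in> shom X (fst (q p)) \<and> snd (q p) (fst p) \<noteq> snd (q p) (snd p)" ..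
  note q = bspec[OF this]
  have "finite ?D" using X by (simp add: finite_semigroup_def)
  then obtain n and e :: "nat \<Rightarrow> 'a \<times> 'a" where e: "?D = e ` {i. i < n}"
    using finite_imp_nat_seg_image_inj_on[of ?D] by blast
  define P where "P = product_semigroup {..<n} (\<lambda>i. fst (q (e i)))"
  define h where "h x = (\<lambda>i \<in> {..<n}. snd (q (e i)) x)" for x
  have mem: "fst (q (e i)) \<in> V \<and> snd (q (e i)) \<in> shom X (fst (q (e i)))" if "i < n" for i
    using q[of "e i"] e that by blast
  have "h \<in> shom X P"
    using mem by (auto simp: shom_def h_def P_def product_semigroup_def fun_eq_iff)
  have inj: "inj_on h (carrier X)"
  proof (rule inj_onI, rule ccontr)
    fix x y assume xy: "x \<in> carrier X" "y \<in> carrier X" "h x = h y" "x \<noteq> y"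
    then have "(x, y) \<in> ?D" by simp
    then obtain i where i: "i < n" "e i = (x, y)" unfolding e by (auto simp: eq_commute)
    then show False
      using q[OF \<open>(x, y) \<in> ?D\<close>] fun_cong[OF xy(3), of i] by (simp add: h_def)
  qed
  have "belongs_to P V" unfolding P_def by (rule pseudovariety_product) (use mem in blast)
  then obtain R g where R: "R \<in> V" "g \<in> shom P R" "bij_betw g (carrier P) (carrier R)"
    unfolding belongs_to_def isomorphic_def by blast
  have sX: "is_semigroup X" using X by (simp add: finite_semigroup_def)
  have gh: "g \<circ> h \<in> shom X R" "inj_on (g \<circ> h) (carrier X)"
    using shom_comp[OF \<open>h \<in> shom X P\<close> R(2)] inj R(3) shom_closed[OF \<open>h \<in> shom X P\<close>]
    by (auto simp: bij_betw_def inj_on_def)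
  let ?I = "\<lparr>carrier = (g \<circ> h) ` carrier X, mult = mult R\<rparr>"
  have "subsemigroup ?I R"
    using shom_image_semigroup[OF sX gh(1)] shom_closed[OF gh(1)] by (auto simp: subsemigroup_def)
  then have "?I \<in> V" using pseudovariety_sub[OF R(1)] by blast
  moreover have "g \<circ> h \<in> shom X ?I" using gh(1) by (auto simp: shom_def)
  moreover have "bij_betw (g \<circ> h) (carrier X) (carrier ?I)" using gh(2) by (simp add: bij_betw_def)
  ultimately show ?thesis unfolding belongs_to_def isomorphic_def by blast
qed

text \<open>The form in which separation is applied: one target \<open>Q\<close> of any element
  type. It covers embeddings, squares and subdirect powers.\<close>

lemma belongs_to_mono_separated:
  fixes X :: "'a semigrp" and Q :: "'b semigrp"
  assumes X: "finite_semigroup X" and Q: "belongs_to Q V"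
    and sep: "\<And>x y. x \<in> carrier X \<Longrightarrow> y \<in> carrier X \<Longrightarrow> x \<noteq> y \<Longrightarrow> \<exists>h \<in> shom X Q. h x \<noteq> h y"
  shows "belongs_to X V"
proof (rule belongs_to_if_separated[OF X])
  obtain R g where R: "R \<in> V" "g \<in> shom Q R" "bij_betw g (carrier Q) (carrier R)"
    using Q unfolding belongs_to_def isomorphic_def by blast
  fix x y assume xy: "x \<in> carrier X" "y \<in> carrier X" "x \<noteq> y"
  then obtain h where h: "h \<in> shom X Q" "h x \<noteq> h y" using sep by blast
  then have "(g \<circ> h) x \<noteq> (g \<circ> h) y"
    using R(3) xy shom_closed[OF h(1)] by (auto simp: bij_betw_def inj_on_def)
  then show "\<exists>Q \<in> V. \<exists>h \<in> shom X Q. h x \<noteq> h y" using R(1) shom_comp[OF h(1) R(2)] by blast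
qed

text \<open>\<open>G\<close> is the graph of a homomorphism from a subsemigroup of \<open>S\<close>
  onto \<open>Y\<close>. Presenting a divisor by its graph allows it to be generated inductively,
  with single-valuedness checked afterwards.\<close>

lemma belongs_to_divisor:
  fixes S :: "'a semigrp" and Y :: "'b semigrp"
  assumes S: "finite_semigroup S" "belongs_to S V" and Y: "finite_semigroup Y"
    and G: "G \<subseteq> carrier S \<times> carrier Y" "snd ` G = carrier Y"
    and closed: "\<And>s t x y. (s, x) \<in> G \<Longrightarrow> (t, y) \<in> G \<Longrightarrow> (s \<cdot>\<^bsub>S\<^esub> t, x \<cdot>\<^bsub>Y\<^esub> y) \<in> G"
    and fn: "\<And>s x y. (s, x) \<in> G \<Longrightarrow> (s, y) \<in> G \<Longrightarrow> x = y"
  shows "belongs_to Y V"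
proof -
  have sS: "is_semigroup S" using S(1) by (simp add: finite_semigroup_def)
  define X where "X = \<lparr>carrier = fst ` G, mult = mult S\<rparr>"
  have "carrier X \<noteq> {}" using G(2) Y by (auto simp: X_def finite_semigroup_def is_semigroup_def)
  moreover have sub: "carrier X \<subseteq> carrier S" using G(1) by (auto simp: X_def)
  moreover have "x \<cdot>\<^bsub>X\<^esub> y \<in> carrier X" if xy: "x \<in> carrier X" "y \<in> carrier X" for x y
  proof -
    obtain x' y' where "(x, x') \<in> G" "(y, y') \<in> G" using xy by (auto simp: X_def)
    from closed[OF this] show ?thesis by (force simp: X_def)
  qed
  ultimately have X: "finite_semigroup X"
    using S(1) finite_subset[OF sub] semigroup_assoc[OF sS]
    by (auto simp: finite_semigroup_def is_semigroup_def subset_iff) (simp add: X_def)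
  have "belongs_to X V"
  proof (rule belongs_to_mono_separated[OF X S(2)])
    show "\<exists>h \<in> shom X S. h x \<noteq> h y" if "x \<noteq> y" for x y
      using that sub by (intro bexI[of _ id]) (auto simp: shom_def X_def)
  qed
  moreover define h where "h s = (THE x. (s, x) \<in> G)" for s
  have h: "h s = x" if "(s, x) \<in> G" for s x
    unfolding h_def using that fn by (intro the_equality) auto
  have "h \<in> shom X Y"
    unfolding shom_def
  proof (intro CollectI conjI ballI)
    fix x y assume "x \<in> carrier X" "y \<in> carrier X"
    then obtain x' y' where xy: "(x, x') \<in> G" "(y, y') \<in> G" by (auto simp: X_def)
    then show "h x \<in> carrier Y" using h G(1) by auto
    show "h (x \<cdot>\<^bsub>X\<^esub> y) = h x \<cdot>\<^bsub>Y\<^esub> h y" using h[OF closed[OF xy]] h xy by (simp add: X_def)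
  qed
  moreover have "h ` carrier X = carrier Y"
    using h unfolding G(2)[symmetric] X_def by (force simp: image_iff)
  ultimately show ?thesis
    using belongs_to_image[OF _ Y] X unfolding finite_semigroup_def by blast
qed

end

text \<open>The image of an epimorphism belongs to \<open>V\<close> and dominates the codomain, so
  saturation leaves it no room to be proper.\<close>

lemma F_epi_closed_if_F_saturated:
  assumes V: "pseudovariety V" and sat: "F_saturated u V"
  shows "F_epi_closed u V"
  unfolding F_epi_closed_def
proof (intro allI impI)
  fix S T :: "nat semigrp" and \<alpha>
  assume *: "S \<in> V \<and> finite_semigroup T \<and> epimorphism u S T \<alpha>"
  let ?A = "\<lparr>carrier = \<alpha> ` carrier S, mult = mult T\<rparr>"
  have \<alpha>: "\<alpha> \<in> shom S T" "dominion u (\<alpha> ` carrier S) T = carrier T"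
    using * unfolding epimorphism_iff_dominion by blast+
  have S: "finite_semigroup S" using pseudovariety_finite[OF V] * by blast
  have A: "is_semigroup ?A"
    using shom_image_semigroup[OF _ \<alpha>(1)] S by (simp add: finite_semigroup_def)
  then have "finite_semigroup ?A" using S by (simp add: finite_semigroup_def)
  moreover have "\<alpha> \<in> shom S ?A" using \<alpha>(1) by (auto simp: shom_def)
  ultimately have AV: "?A \<in> V" using pseudovariety_image[OF V, of S ?A \<alpha>] * by simp
  then have "F_saturated_semigroup u ?A" using sat AV by (simp add: F_saturated_def)
  moreover have "subsemigroup ?A T" using A shom_closed[OF \<alpha>(1)] by (auto simp: subsemigroup_def)
  ultimately have "\<alpha> ` carrier S = carrier T"
    using \<alpha>(2) * unfolding F_saturated_semigroup_def by (auto dest: spec[of _ T])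
  \<comment> \<open>Equality of records, not just isomorphism, since \<open>?A\<close> was given the
    operation of \<open>T\<close>.\<close>
  then have "?A = T" by simp
  with AV show "T \<in> V" by simp
qed

section \<open>The pseudovarieties \<open>V\<^sub>1\<close>, \<open>V\<^sub>2\<close>, \<open>V\<^sub>3\<close>\<close>

text \<open>A common index lets the closure properties of the three classes be proved once. Every
  \<open>i\<close> other than 1 and 2 stands for the third identity.\<close>

definition identity_lhs :: "nat \<Rightarrow> 'a semigrp \<Rightarrow> 'a \<Rightarrow> 'a \<Rightarrow> 'a \<Rightarrow> 'a" where
  "identity_lhs i S x e f = (let w = e \<cdot>\<^bsub>S\<^esub> x \<cdot>\<^bsub>S\<^esub> f; c = omega S (e \<cdot>\<^bsub>S\<^esub> f) in
     if i = 1 then omega_plus_1 S w else if i = 2 then w \<cdot>\<^bsub>S\<^esub> c else c \<cdot>\<^bsub>S\<^esub> w)"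

definition satisfies :: "nat \<Rightarrow> 'a semigrp \<Rightarrow> bool" where
  "satisfies i S \<longleftrightarrow> (\<forall>x \<in> carrier S. \<forall>e f. idempotent S e \<and> idempotent S f \<longrightarrow>
     identity_lhs i S x e f = e \<cdot>\<^bsub>S\<^esub> x \<cdot>\<^bsub>S\<^esub> f)"

lemma V_satisfies:
  "V1 = {S. finite_semigroup S \<and> satisfies 1 S}"
  "V2 = {S. finite_semigroup S \<and> satisfies 2 S}"
  "V3 = {S. finite_semigroup S \<and> satisfies 3 S}"
  by (simp_all add: V1_def V2_def V3_def satisfies_def identity_lhs_def Let_def)

lemma power_Suc_shom:
  assumes "is_semigroup S" "h \<in> shom S T" "s \<in> carrier S"
  shows "power_Suc T (h s) n = h (power_Suc S s n)"
  by (induction n) (simp_all add: shom_mult[OF assms(2)] power_Suc_closed[OF assms(1,3)] assms(3))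

lemma idempotent_shom: "h \<in> shom S T \<Longrightarrow> idempotent S e \<Longrightarrow> idempotent T (h e)"
  by (simp add: idempotent_def shom_closed shom_mult[symmetric])

lemma omega_shom:
  assumes S: "finite_semigroup S" and T: "is_semigroup T" and h: "h \<in> shom S T" "s \<in> carrier S"
  shows "omega T (h s) = h (omega S s)"
proof -
  note sS = finite_semigroup_is_semigroup[OF S]
  obtain n where n: "idempotent S (power_Suc S s n)" using idempotent_power_Suc[OF S h(2)] by blast
  then have "idempotent T (power_Suc T (h s) n)"
    using idempotent_shom[OF h(1)] power_Suc_shom[OF sS h] by simp
  then show ?thesis
    using omega_power_Suc[OF T shom_closed[OF h]] omega_power_Suc[OF sS h(2) n]
      power_Suc_shom[OF sS h] by simp
qed

lemma identity_lhs_closed: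
  assumes "finite_semigroup S" "x \<in> carrier S" "e \<in> carrier S" "f \<in> carrier S"
  shows "identity_lhs i S x e f \<in> carrier S"
  using assms semigroup_closed[OF finite_semigroup_is_semigroup[OF assms(1)]] omega_in_carrier[OF assms(1)]
  by (simp add: identity_lhs_def omega_plus_1_def Let_def)

lemma identity_lhs_shom:
  assumes S: "finite_semigroup S" and T: "is_semigroup T" and h: "h \<in> shom S T"
    and "x \<in> carrier S" "e \<in> carrier S" "f \<in> carrier S"
  shows "identity_lhs i T (h x) (h e) (h f) = h (identity_lhs i S x e f)"
  using assms(4-) semigroup_closed[OF finite_semigroup_is_semigroup[OF S]] omega_in_carrier[OF S]
  by (simp add: identity_lhs_def omega_plus_1_def Let_def shom_mult[OF h, symmetric]
      omega_shom[OF S T h])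

lemma satisfies_image:
  assumes S: "finite_semigroup S" "satisfies i S" and T: "is_semigroup T"
    and h: "h \<in> shom S T" "h ` carrier S = carrier T"
  shows "satisfies i T"
  unfolding satisfies_def
proof (intro ballI allI impI)
  note sS = finite_semigroup_is_semigroup[OF S(1)]
  \<comment> \<open>Idempotents lift along surjections: the \<open>omega\<close> power of any
    preimage of \<open>e\<close> is mapped to \<open>omega T e = e\<close>.\<close>
  have lift: "\<exists>e'. idempotent S e' \<and> h e' = e" if "idempotent T e" for e
  proof -
    obtain s where s: "s \<in> carrier S" "e = h s" using \<open>idempotent T e\<close> h(2) by (auto simp: idempotent_def)
    have "omega T e = e"
      using omega_power_Suc[OF T, of e 0] that by (simp add: idempotent_def)
    moreover obtain n where n: "idempotent S (power_Suc S s n)"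
      using idempotent_power_Suc[OF S(1) s(1)] by blast
    ultimately show ?thesis
      using omega_shom[OF S(1) T h(1) s(1)] omega_power_Suc[OF sS s(1) n] s(2) by auto
  qed
  fix x e f assume x: "x \<in> carrier T" and "idempotent T e \<and> idempotent T f"
  then obtain e' f' where ef: "idempotent S e'" "h e' = e" "idempotent S f'" "h f' = f"
    using lift by meson
  then have ef': "e' \<in> carrier S" "f' \<in> carrier S" by (auto simp: idempotent_def)
  obtain x' where x': "x' \<in> carrier S" "h x' = x" using x unfolding h(2)[symmetric] by blast
  have "identity_lhs i S x' e' f' = e' \<cdot>\<^bsub>S\<^esub> x' \<cdot>\<^bsub>S\<^esub> f'"
    using S(2) ef x' unfolding satisfies_def by blast
  then have "identity_lhs i T (h x') (h e') (h f') = h (e' \<cdot>\<^bsub>S\<^esub> x' \<cdot>\<^bsub>S\<^esub> f')"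
    using identity_lhs_shom[OF S(1) T h(1) x'(1) ef'] by simp
  then show "identity_lhs i T x e f = e \<cdot>\<^bsub>T\<^esub> x \<cdot>\<^bsub>T\<^esub> f"
    using x' ef ef' semigroup_closed[OF sS] by (simp add: shom_mult[OF h(1)])
qed

lemma satisfies_sub:
  assumes S: "finite_semigroup S" "satisfies i S" and T: "subsemigroup T S"
  shows "satisfies i T"
  unfolding satisfies_def
proof (intro ballI allI impI)
  have sT: "is_semigroup T" and h: "id \<in> shom T S"
    using T by (auto simp: subsemigroup_def shom_def)
  have fT: "finite_semigroup T"
    using T S(1) finite_subset unfolding subsemigroup_def finite_semigroup_def by blast
  fix x e f assume x: "x \<in> carrier T" and ef: "idempotent T e \<and> idempotent T f"
  have ef': "e \<in> carrier T" "f \<in> carrier T" using ef by (auto simp: idempotent_def)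
  have "identity_lhs i S x e f = e \<cdot>\<^bsub>S\<^esub> x \<cdot>\<^bsub>S\<^esub> f"
    using S(2) x ef idempotent_shom[OF h] shom_closed[OF h x] unfolding satisfies_def by simp
  then show "identity_lhs i T x e f = e \<cdot>\<^bsub>T\<^esub> x \<cdot>\<^bsub>T\<^esub> f"
    using identity_lhs_shom[OF fT finite_semigroup_is_semigroup[OF S(1)] h x ef', of i] x ef'
      semigroup_closed[OF sT] shom_mult[OF h] by simp
qed

lemma product_semigroup_proj: "i \<in> I \<Longrightarrow> (\<lambda>x. x i) \<in> shom (product_semigroup I F) (F i)"
  by (auto simp: shom_def product_semigroup_def)

lemma finite_product_semigroup:
  assumes "finite I" "\<And>i. i \<in> I \<Longrightarrow> finite_semigroup (F i)"
  shows "finite_semigroup (product_semigroup I F)"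
proof -
  have F: "is_semigroup (F i)" "finite (carrier (F i))" if "i \<in> I" for i
    using assms(2)[OF that] by (auto simp: finite_semigroup_def)
  have "carrier (F i) \<noteq> {}" if "i \<in> I" for i using F(1)[OF that] by (simp add: is_semigroup_def)
  then show ?thesis
    unfolding finite_semigroup_def is_semigroup_def
    using semigroup_closed[OF F(1)] semigroup_assoc[OF F(1)] F(2) assms(1)
    by (auto simp: product_semigroup_def PiE_eq_empty_iff PiE_iff fun_eq_iff intro!: finite_PiE)
qed

lemma satisfies_product:
  assumes I: "finite I" and F: "\<And>j. j \<in> I \<Longrightarrow> finite_semigroup (F j)" "\<And>j. j \<in> I \<Longrightarrow> satisfies i (F j)"
  shows "satisfies i (product_semigroup I F)" (is "satisfies i ?P")
  unfolding satisfies_def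
proof (intro ballI allI impI)
  have P: "finite_semigroup ?P" by (rule finite_product_semigroup[OF I F(1)])
  note sP = finite_semigroup_is_semigroup[OF P]
  fix x e f assume x: "x \<in> carrier ?P" and ef: "idempotent ?P e \<and> idempotent ?P f"
  have ef': "e \<in> carrier ?P" "f \<in> carrier ?P" using ef by (auto simp: idempotent_def)
  let ?l = "identity_lhs i ?P x e f" and ?r = "e \<cdot>\<^bsub>?P\<^esub> x \<cdot>\<^bsub>?P\<^esub> f"
  have "?l \<in> carrier ?P" "?r \<in> carrier ?P"
    using identity_lhs_closed[OF P x ef'] semigroup_closed[OF sP] x ef' by auto
  then have "?l \<in> Pi\<^sub>E I (\<lambda>j. carrier (F j))" "?r \<in> Pi\<^sub>E I (\<lambda>j. carrier (F j))"
    by (simp_all add: product_semigroup_def)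
  then show "?l = ?r"
  proof (rule PiE_ext)
    fix j assume j: "j \<in> I"
    note h = product_semigroup_proj[OF j, of F]
    have "?l j = identity_lhs i (F j) (x j) (e j) (f j)"
      using identity_lhs_shom[OF P finite_semigroup_is_semigroup[OF F(1)[OF j]] h x ef'] by simp
    also have "\<dots> = e j \<cdot>\<^bsub>F j\<^esub> x j \<cdot>\<^bsub>F j\<^esub> f j"
      using F(2)[OF j] shom_closed[OF h x] ef idempotent_shom[OF h] unfolding satisfies_def by blast
    also have "\<dots> = ?r j"
      using shom_mult[OF h] semigroup_closed[OF sP] x ef' by simp
    finally show "?l j = ?r j" .
  qed
qed

lemma pseudovariety_satisfies: "pseudovariety {S. finite_semigroup S \<and> satisfies i S}"
  unfolding pseudovariety_def
proof (intro conjI allI impI)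
  show "{S. finite_semigroup S \<and> satisfies i S} \<subseteq> finite_semigroups"
    by (auto simp: finite_semigroups_def)
next
  fix S T :: "nat semigrp" and h
  assume "S \<in> {S. finite_semigroup S \<and> satisfies i S} \<and> finite_semigroup T \<and> h \<in> shom S T \<and>
    h ` carrier S = carrier T"
  then show "T \<in> {S. finite_semigroup S \<and> satisfies i S}"
    using satisfies_image[of S i T h] finite_semigroup_is_semigroup[of T] by blast
next
  fix S T :: "nat semigrp"
  assume *: "S \<in> {S. finite_semigroup S \<and> satisfies i S} \<and> subsemigroup T S"
  then have "finite_semigroup T"
    using finite_subset unfolding subsemigroup_def finite_semigroup_def by blast
  then show "T \<in> {S. finite_semigroup S \<and> satisfies i S}" using * satisfies_sub by blast
next
  fix n :: nat and F :: "nat \<Rightarrow> nat semigrp"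
  assume F: "\<forall>j < n. F j \<in> {S. finite_semigroup S \<and> satisfies i S}"
  let ?P = "product_semigroup {..<n} F"
  have P: "finite_semigroup ?P" "satisfies i ?P"
    using finite_product_semigroup[of "{..<n}" F] satisfies_product[of "{..<n}" F i] F by auto
  obtain f :: "(nat \<Rightarrow> nat) \<Rightarrow> nat" where f: "inj_on f (carrier ?P)"
    using finite_semigroup_nat_inj[OF P(1)] .
  have "satisfies i (nat_copy f ?P)"
    using satisfies_image[OF P _ nat_copy_shom[OF f]] nat_copy_semigroup[OF f P(1)]
    by (simp add: finite_semigroup_def nat_copy_simps(1)[OF f])
  then show "belongs_to ?P {S. finite_semigroup S \<and> satisfies i S}"
    unfolding belongs_to_def isomorphic_def
    using nat_copy_semigroup[OF f P(1)] nat_copy_shom[OF f] f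
    by (intro bexI[of _ "nat_copy f ?P"] bexI[of _ f])
      (auto simp: bij_betw_def nat_copy_simps(1)[OF f])
qed

section \<open>Dividing by \<open>Y\<close>\<close>

context monoid_mult
begin

text \<open>\<open>M\<close> contains the words in \<open>e\<close>, \<open>f\<close> that have the letter \<open>e\<close>,
  and \<open>B\<close> the words with the letter \<open>a\<close> not in \<open>e\<^sup>*af\<^sup>*\<close>.\<close>

definition separating :: "'a \<Rightarrow> 'a \<Rightarrow> 'a \<Rightarrow> 'a set \<Rightarrow> 'a set \<Rightarrow> bool" where
  "separating e f a M B \<longleftrightarrow> e * e = e \<and> f * f = f \<and> e * a = a \<and> a * f = a \<and> a * a \<noteq> a \<and>
     e \<in> M \<and> e * f \<in> M \<and> (\<forall>m \<in> M. e * m \<in> M \<and> f * m \<in> M \<and> a * m \<in> B) \<and>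
     (\<forall>b \<in> B. e * b \<in> B \<and> f * b \<in> B \<and> a * b \<in> B) \<and> f * a \<in> B \<and> a * a \<in> B \<and> a \<notin> B"

text \<open>For regular \<open>a\<close> the idempotents \<open>a * b\<close> and
  \<open>b * a\<close> serve as \<open>e\<close> and \<open>f\<close>. Each of the factors
  \<open>f * a\<close>, \<open>a * e\<close> and \<open>f * e\<close> then contains
  \<open>a * a\<close>, while \<open>a\<close> is not \<open>J\<close>-below
  \<open>a * a\<close>.\<close>

lemma separating_regular:
  assumes N: "finite_submonoid N" "a \<in> N" "b \<in> N" and a: "a = a * b * a"
    and np: "\<And>j. a * a ^ Suc j \<noteq> a"
  shows "\<exists>M B. separating (a * b) (b * a) a M B"
proof -
  have cl: "x * y \<in> N" if "x \<in> N" "y \<in> N" for x y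
    using N(1) that unfolding finite_submonoid_def by blast
  define e f where "e = a * b" and "f = b * a"
  have ef: "e \<in> N" "f \<in> N" using cl N unfolding e_def f_def by blast+
  \<comment> \<open>A word with the letter \<open>e\<close> begins with it or contains
    \<open>f * e\<close>.\<close>
  define M where "M = {e * r |r. True} \<union> {p * f * e * r |p r. p \<in> N}"
  define B where "B = {p * (a * a) * q |p q. p \<in> N}"
  have BI: "x \<in> B" if "p \<in> N" "x = p * (a * a) * q" for x p q using that unfolding B_def by blast
  have MI: "e * r \<in> M" "p \<in> N \<Longrightarrow> p * f * e * r \<in> M" for p r unfolding M_def by blast+
  have ee: "e * e = e" "f * f = f" "e * a = a" "a * f = a"
    using a unfolding e_def f_def by (metis mult.assoc)+
  have one: "1 \<in> N" using N(1) unfolding finite_submonoid_def by blast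
  have "separating e f a M B"
    unfolding separating_def
  proof (intro conjI ballI)
    show "a * a \<noteq> a" using np[of 0] by simp
    show "e \<in> M" "e * f \<in> M" using MI(1)[of 1] MI(1)[of f] by simp_all
    show "a * a \<in> B" "f * a \<in> B"
      using BI[OF one, of "a * a" 1] BI[OF N(3), of "f * a" 1] unfolding f_def by (simp_all add: mult.assoc)
    show "a \<notin> B"
    proof
      assume "a \<in> B"
      then obtain p q where "p \<in> N" "a = p * (a * a) * q" unfolding B_def by blast
      then show False using power_fixed_of_square_above[OF N(1) _ N(2)] np by blast
    qed
  next
    fix m assume m: "m \<in> M"
    then consider r where "m = e * r" | p r where "p \<in> N" "m = p * f * e * r" unfolding M_def by blast
    then have "e * m \<in> M \<and> f * m \<in> M \<and> a * m \<in> B"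
    proof cases
      case 1
      then show ?thesis
        using MI(1)[of r] MI(2)[OF one, of r] BI[OF one, of "a * m" "b * r"] ee(1)
        by (simp add: mult.assoc[symmetric]) (simp add: e_def mult.assoc)
    next
      case 2
      then show ?thesis
        using MI(2)[OF cl[OF ef(1) 2(1)], of r] MI(2)[OF cl[OF ef(2) 2(1)], of r]
          BI[OF cl[OF cl[OF N(2) 2(1)] N(3)], of "a * m" "b * r"]
        by (simp add: mult.assoc) (simp add: e_def f_def mult.assoc)
    qed
    then show "e * m \<in> M" "f * m \<in> M" "a * m \<in> B" by blast+
  next
    fix x assume "x \<in> B"
    then obtain p q where x: "p \<in> N" "x = p * (a * a) * q" unfolding B_def by blast
    have "y * x \<in> B" if "y \<in> N" for y
      using BI[OF cl[OF that x(1)], of "y * x" q] x(2) by (simp add: mult.assoc)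
    then show "e * x \<in> B" "f * x \<in> B" "a * x \<in> B" using ef N(2) by blast+
  qed (use ee in auto)
  then show ?thesis unfolding e_def f_def by blast
qed

text \<open>Since \<open>e * a = a\<close> and \<open>a * f = a\<close>, what remains before the
  first \<open>a\<close> and after the last \<open>a\<close> of a word is an alternating word in
  \<open>e\<close> and \<open>f\<close>. Outside \<open>e*af*\<close> one of these ends is
  nontrivial, or the word has the form \<open>a * z * a\<close>. In the first case the value
  \<open>a\<close> would, by absorption, be fixed by a power of \<open>e * f\<close>; in the second
  \<open>a\<close> would be regular.\<close>

lemma separating_nonregular:
  assumes N: "finite_submonoid N" "a \<in> N" "e \<in> N" "f \<in> N"
    and ef: "e * e = e" "f * f = f" "e * a = a" "a * f = a"
    and np: "\<And>j. a * a ^ Suc j \<noteq> a" "\<And>j. (e * f) ^ Suc j * a \<noteq> a" "\<And>j. a * (e * f) ^ Suc j \<noteq> a"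
    and nr: "\<And>b. b \<in> N \<Longrightarrow> a \<noteq> a * b * a"
  shows "\<exists>M B. separating e f a M B"
proof -
  have cl: "x * y \<in> N" if "x \<in> N" "y \<in> N" for x y
    using N(1) that unfolding finite_submonoid_def by blast
  have one: "1 \<in> N" using N(1) unfolding finite_submonoid_def by blast
  define c where "c = e * f"
  have c: "c \<in> N" "e * c = c" "c * f = c"
    using cl N ef unfolding c_def by (auto simp: mult.assoc) (metis mult.assoc)
  have npc: "c ^ Suc k * a * v \<noteq> a" "v * a * c ^ Suc k \<noteq> a" for k v
  proof -
    have cN: "c ^ Suc k \<in> N" using finite_submonoid_power[OF N(1) c(1)] .
    have *: "(c ^ Suc k) ^ Suc j = c ^ Suc (k * Suc j + j)" for j
      by (simp only: power_mult[symmetric]) (simp add: algebra_simps)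
    show "c ^ Suc k * a * v \<noteq> a"
      using absorb_left[OF N(1) cN, of a v] np(2) * unfolding c_def by metis
    show "v * a * c ^ Suc k \<noteq> a"
      using absorb_right[OF N(1) cN, of a v] np(3) * unfolding c_def by metis
  qed
  have ec: "e * c ^ Suc k = c ^ Suc k" for k using c(2) by (simp add: mult.assoc[symmetric])
  have fc: "e * (f * c ^ k) = c ^ Suc k" for k by (simp add: c_def mult.assoc)
  define L where "L = {c ^ Suc k * a * v |k v. True} \<union> {f * c ^ k * a * v |k v. True}"
  define R where "R = {v * a * c ^ Suc k |k v. True} \<union> {v * a * c ^ k * e |k v. True}"
  \<comment> \<open>Words in \<open>L\<close> are kept only if they end in \<open>a\<close>, so that
    left multiplication by \<open>a\<close> takes them into the third set.\<close>
  define B where "B = R \<union> (L \<inter> {v * a |v. v \<in> N}) \<union> {a * z * a |z. z \<in> N}"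
  \<comment> \<open>The alternating words with the letter \<open>e\<close>, sorted by their first
    and last letters.\<close>
  define M where "M = {c ^ Suc k |k. True} \<union> {c ^ k * e |k. True} \<union> {f * c ^ Suc k |k. True} \<union>
    {f * c ^ k * e |k. True}"
  have aR: "a \<notin> R"
  proof
    assume "a \<in> R"
    then consider k v where "a = v * a * c ^ Suc k" | k v where "a = v * a * c ^ k * e"
      unfolding R_def by blast
    then show False
    proof cases
      case (2 k v)
      then have "v * a * c ^ Suc k = a" using ef(4)
        by (metis c_def mult.assoc power_Suc2)
      then show False using npc by blast
    qed (use npc in metis)
  qed
  have aL: "a \<notin> L"
  proof
    assume "a \<in> L"
    then consider k v where "a = c ^ Suc k * a * v" | k v where "a = f * c ^ k * a * v"
      unfolding L_def by blast
    then show False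
    proof cases
      case (2 k v)
      then have "c ^ Suc k * a * v = a" using ef(3) fc
        by (metis mult.assoc)
      then show False using npc by blast
    qed (use npc in metis)
  qed
  have Rcl: "y * x \<in> R" if "x \<in> R" for x y
  proof -
    from that consider k v where "x = v * a * c ^ Suc k" | k v where "x = v * a * c ^ k * e"
      unfolding R_def by blast
    then show ?thesis
    proof cases
      case (1 k v)
      then have "y * x = (y * v) * a * c ^ Suc k" by (simp add: mult.assoc)
      then show ?thesis unfolding R_def by blast
    next
      case (2 k v)
      then have "y * x = (y * v) * a * c ^ k * e" by (simp add: mult.assoc)
      then show ?thesis unfolding R_def by blast
    qed
  qed
  have Lcl: "e * x \<in> L \<and> f * x \<in> L" if "x \<in> L" for x
  proof -
    have LI: "c ^ Suc k * a * v \<in> L" "f * c ^ k * a * v \<in> L" for k v unfolding L_def by blast+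
    from that consider k v where "x = c ^ Suc k * a * v" | k v where "x = f * c ^ k * a * v"
      unfolding L_def by blast
    then show ?thesis
    proof cases
      case (1 k v)
      then have "e * x = c ^ Suc k * a * v" "f * x = f * c ^ Suc k * a * v"
        using ec[of k] by (simp_all only: mult.assoc[symmetric])
      then show ?thesis using LI by metis
    next
      case (2 k v)
      then have "e * x = c ^ Suc k * a * v" "f * x = f * c ^ k * a * v"
        using fc[of k] ef(2) by (simp_all only: mult.assoc[symmetric])
      then show ?thesis using LI by metis
    qed
  qed
  have fa: "f * a * v \<in> L" for v
  proof -
    have "f * a * v = f * c ^ 0 * a * v" by simp
    then show ?thesis unfolding L_def by blast
  qed
  have Mcl: "e * m \<in> M \<and> f * m \<in> M \<and> a * m \<in> B" if "m \<in> M" for m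
  proof -
    have MI: "c ^ Suc k \<in> M" "c ^ k * e \<in> M" "f * c ^ Suc k \<in> M" "f * c ^ k * e \<in> M" for k
      unfolding M_def by blast+
    have RI: "a * c ^ Suc k \<in> B" "a * c ^ k * e \<in> B" for k
    proof -
      have "a * c ^ Suc k = 1 * a * c ^ Suc k" "a * c ^ k * e = 1 * a * c ^ k * e" by simp_all
      then show "a * c ^ Suc k \<in> B" "a * c ^ k * e \<in> B" unfolding B_def R_def by blast+
    qed
    have ece: "e * (c ^ k * e) = c ^ k * e" for k
      using ec ef(1) by (cases k) (simp_all add: mult.assoc[symmetric] del: power_Suc)
    from that consider k where "m = c ^ Suc k" | k where "m = c ^ k * e"
      | k where "m = f * c ^ Suc k" | k where "m = f * c ^ k * e" unfolding M_def by blast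
    then show ?thesis
    proof cases
      case (1 k)
      then show ?thesis using ec MI(1,3)[of k] RI(1)[of k] by (simp del: power_Suc)
    next
      case (2 k)
      then show ?thesis using ece MI(2,4)[of k] RI(2)[of k] by (simp add: mult.assoc)
    next
      case (3 k)
      then have "e * m = c ^ Suc (Suc k)" "f * m = m" "a * m = a * c ^ Suc k"
        using fc[of "Suc k"] ef by (simp_all only: mult.assoc[symmetric])
      then show ?thesis using MI(1)[of "Suc k"] RI(1)[of k] that by metis
    next
      case (4 k)
      then have "e * m = c ^ Suc k * e" "f * m = m" "a * m = a * c ^ k * e"
        using fc[of k] ef by (simp_all only: mult.assoc[symmetric])
      then show ?thesis using MI(2)[of "Suc k"] RI(2)[of k] that by metis
    qed
  qed
  have Bcl: "e * x \<in> B \<and> f * x \<in> B \<and> a * x \<in> B" if x: "x \<in> B" for x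
  proof -
    from x consider "x \<in> R" | v where "x \<in> L" "x = v * a" "v \<in> N"
      | z where "z \<in> N" "x = a * z * a" unfolding B_def by blast
    then show ?thesis
    proof cases
      case 1
      then show ?thesis using Rcl unfolding B_def by blast
    next
      case (2 v)
      have "e * x = (e * v) * a" "f * x = (f * v) * a" "a * x = a * v * a"
        using 2 by (simp_all add: mult.assoc)
      then show ?thesis using Lcl[OF 2(1)] cl 2(3) N unfolding B_def by blast
    next
      case (3 z)
      have "e * x \<in> B" using x 3 ef(3) by (simp add: mult.assoc[symmetric])
      moreover have "f * x \<in> B"
      proof -
        have "f * x = (f * a * z) * a" "f * x = f * a * (z * a)" using 3 by (simp_all add: mult.assoc)
        moreover have "f * a * z \<in> N" using cl 3 N by blast
        ultimately show ?thesis using fa[of "z * a"] unfolding B_def by auto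
      qed
      moreover have "a * x \<in> B"
      proof -
        have "a * x = a * (a * z) * a" using 3 by (simp add: mult.assoc)
        moreover have "a * z \<in> N" using cl 3 N by blast
        ultimately show ?thesis unfolding B_def by blast
      qed
      ultimately show ?thesis by blast
    qed
  qed
  have "separating e f a M B"
    unfolding separating_def
  proof (intro conjI ballI)
    show "a * a \<noteq> a" using np(1)[of 0] by simp
    have "e = c ^ 0 * e" "e * f = c ^ Suc 0" by (simp_all add: c_def)
    then show "e \<in> M" "e * f \<in> M" unfolding M_def by blast+
    have "f * a \<in> L" using fa[of 1] by simp
    then show "f * a \<in> B" using N(4) unfolding B_def by blast
    have "a * a = a * 1 * a" by simp
    then show "a * a \<in> B" using one unfolding B_def by blast
    show "a \<notin> B" using aR aL nr unfolding B_def by blast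
  qed (use ef Mcl Bcl in auto)
  then show ?thesis by blast
qed

end

text \<open>Words are built by prefixing one generator at a time, which matches the closure of
  \<open>M\<close> and \<open>B\<close> under left multiplication by \<open>e\<close>,
  \<open>f\<close> and \<open>a\<close>.\<close>

inductive_set word_graph :: "'a semigrp \<Rightarrow> 'a \<Rightarrow> 'a \<Rightarrow> 'a \<Rightarrow> (('a \<times> 'a) \<times> brandt) set"
  for S e f a where
  gen: "(g, y) \<in> {((e, e), B2_ab), ((f, f), B2_ba), ((a, a \<cdot>\<^bsub>S\<^esub> a), B2_a)} \<Longrightarrow> (g, y) \<in> word_graph S e f a"
| mult: "((g, g'), y) \<in> {((e, e), B2_ab), ((f, f), B2_ba), ((a, a \<cdot>\<^bsub>S\<^esub> a), B2_a)} \<Longrightarrow>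
    ((s, s'), z) \<in> word_graph S e f a \<Longrightarrow>
    ((g \<cdot>\<^bsub>S\<^esub> s, g' \<cdot>\<^bsub>S\<^esub> s'), brandt_mult y z) \<in> word_graph S e f a"

definition square :: "'a semigrp \<Rightarrow> ('a \<times> 'a) semigrp" where
  "square S = \<lparr>carrier = carrier S \<times> carrier S,
     mult = (\<lambda>(x, x') (y, y'). (x \<cdot>\<^bsub>S\<^esub> y, x' \<cdot>\<^bsub>S\<^esub> y'))\<rparr>"

lemma finite_semigroup_square:
  assumes "finite_semigroup S"
  shows "finite_semigroup (square S)"
proof -
  note S = finite_semigroup_is_semigroup[OF assms]
  show ?thesis
    using assms semigroup_closed[OF S] semigroup_assoc[OF S]
    by (auto simp: finite_semigroup_def is_semigroup_def square_def)
qed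

lemma finite_semigroup_Y: "finite_semigroup Y_semigroup"
  unfolding finite_semigroup_def is_semigroup_def by (simp add: Y_semigroup_def)

text \<open>The second coordinate \<open>a\<^sup>2\<close> keeps the generator apart from the words in \<open>e\<close>, \<open>f\<close>
  alone, whose two coordinates agree.\<close>

lemma belongs_to_Y_if_separating:
  fixes S :: "'a semigrp"
  assumes V: "pseudovariety V" and S: "finite_semigroup S" "belongs_to S V"
    and efa: "e \<in> carrier S" "f \<in> carrier S" "a \<in> carrier S"
    and sep: "monoid_mult.separating (with_one S) (Some e) (Some f) (Some a) M B"
  shows "belongs_to Y_semigroup V"
proof -
  note sS = finite_semigroup_is_semigroup[OF S(1)]
  interpret monoid_mult None "with_one S" by (rule monoid_with_one[OF sS])
  note cl = semigroup_closed[OF sS] and as = semigroup_assoc[OF sS]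
  let ?G = "word_graph S e f a" and ?aa = "a \<cdot>\<^bsub>S\<^esub> a"
  have rel: "e \<cdot>\<^bsub>S\<^esub> e = e" "f \<cdot>\<^bsub>S\<^esub> f = f" "e \<cdot>\<^bsub>S\<^esub> a = a" "a \<cdot>\<^bsub>S\<^esub> f = a" "?aa \<noteq> a"
    and M: "Some e \<in> M" "Some (e \<cdot>\<^bsub>S\<^esub> f) \<in> M" and B: "Some (f \<cdot>\<^bsub>S\<^esub> a) \<in> B" "Some ?aa \<in> B" "Some a \<notin> B"
    using sep efa unfolding separating_def by simp_all
  have MB: "Some m \<in> M \<Longrightarrow> Some (e \<cdot>\<^bsub>S\<^esub> m) \<in> M \<and> Some (f \<cdot>\<^bsub>S\<^esub> m) \<in> M \<and> Some (a \<cdot>\<^bsub>S\<^esub> m) \<in> B"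
    "Some m \<in> B \<Longrightarrow> Some (e \<cdot>\<^bsub>S\<^esub> m) \<in> B \<and> Some (f \<cdot>\<^bsub>S\<^esub> m) \<in> B \<and> Some (a \<cdot>\<^bsub>S\<^esub> m) \<in> B"
    if "m \<in> carrier S" for m
  proof -
    have "with_one S (Some g) (Some m) = Some (g \<cdot>\<^bsub>S\<^esub> m)" if "g \<in> carrier S" for g
      using that \<open>m \<in> carrier S\<close> by simp
    then show "Some m \<in> M \<Longrightarrow> Some (e \<cdot>\<^bsub>S\<^esub> m) \<in> M \<and> Some (f \<cdot>\<^bsub>S\<^esub> m) \<in> M \<and> Some (a \<cdot>\<^bsub>S\<^esub> m) \<in> B"
      "Some m \<in> B \<Longrightarrow> Some (e \<cdot>\<^bsub>S\<^esub> m) \<in> B \<and> Some (f \<cdot>\<^bsub>S\<^esub> m) \<in> B \<and> Some (a \<cdot>\<^bsub>S\<^esub> m) \<in> B"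
      using sep efa unfolding separating_def by metis+
  qed
  \<comment> \<open>The invariant behind single-valuedness. Over zero there are two kinds of words:
    those in \<open>e\<close> and \<open>f\<close> alone, with equal coordinates in
    \<open>M\<close>, and those with the letter \<open>a\<close>, with first coordinate in
    \<open>B\<close>.\<close>
  have inv: "s \<in> carrier S \<and> s' \<in> carrier S \<and> (y = B2_ab \<and> s = e \<and> s' = e \<or> y = B2_ba \<and> s = f \<and> s' = f \<or>
      y = B2_a \<and> s = a \<and> s' = ?aa \<or> y = B2_0 \<and> (s = s' \<and> Some s \<in> M \<or> Some s \<in> B))"
    if "((s, s'), y) \<in> ?G" for s s' y
    using that
  proof (induction "(s, s')" y arbitrary: s s' rule: word_graph.induct)
    case (gen y)
    then show ?case using efa cl by auto
  next
    case (mult g g' y s s' z)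
    have g: "g \<in> carrier S" "g' \<in> carrier S" using mult(1) efa cl by auto
    have m: "e \<cdot>\<^bsub>S\<^esub> ?aa = ?aa" "?aa \<cdot>\<^bsub>S\<^esub> f = ?aa" using efa rel as[of e a a] as[of a a f] by simp_all
    have "Some (a \<cdot>\<^bsub>S\<^esub> e) \<in> B" "Some (f \<cdot>\<^bsub>S\<^esub> e) \<in> M" using MB(1) M(1) efa by blast+
    have gens: "y = B2_ab \<and> g = e \<and> g' = e \<or> y = B2_ba \<and> g = f \<and> g' = f \<or>
        y = B2_a \<and> g = a \<and> g' = ?aa" using mult(1) by auto
    have cls: "g \<cdot>\<^bsub>S\<^esub> s \<in> carrier S" "g' \<cdot>\<^bsub>S\<^esub> s' \<in> carrier S" using mult(3) g cl by blast+
    have s: "s \<in> carrier S" "s' \<in> carrier S"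
      and "z = B2_ab \<and> s = e \<and> s' = e \<or> z = B2_ba \<and> s = f \<and> s' = f \<or>
        z = B2_a \<and> s = a \<and> s' = ?aa \<or> z = B2_0 \<and> (s = s' \<and> Some s \<in> M \<or> Some s \<in> B)"
      using mult(3) by blast+
    then consider "z = B2_ab" "s = e" "s' = e" | "z = B2_ba" "s = f" "s' = f"
      | "z = B2_a" "s = a" "s' = ?aa" | "z = B2_0" "s = s'" "Some s \<in> M" | "z = B2_0" "Some s \<in> B"
      by blast
    then show ?case
    proof cases
      case 1
      then show ?thesis using gens cls rel(1) \<open>Some (a \<cdot>\<^bsub>S\<^esub> e) \<in> B\<close> \<open>Some (f \<cdot>\<^bsub>S\<^esub> e) \<in> M\<close> by auto
    next
      case 2
      then show ?thesis using gens cls rel(2,4) m(2) M(2) by auto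
    next
      case 3
      then show ?thesis using gens cls rel(3) m(1) B(1,2) by auto
    next
      case 4
      then show ?thesis using gens cls MB(1)[OF s(1)] by auto
    next
      case 5
      then show ?thesis using gens cls MB(2)[OF s(1)] by auto
    qed
  qed
  \<comment> \<open>Diagonal pairs are excluded by \<open>?aa \<noteq> a\<close>, and a first
    coordinate in \<open>B\<close> by \<open>a\<close> not being there.\<close>
  have G0: "y = B2_a" if "((a, ?aa), y) \<in> ?G" for y
    using inv[OF that] rel B by auto
  have closed: "((s \<cdot>\<^bsub>S\<^esub> t, s' \<cdot>\<^bsub>S\<^esub> t'), brandt_mult x y) \<in> ?G"
    if "((s, s'), x) \<in> ?G" "((t, t'), y) \<in> ?G" for s s' t t' x y
    using that(1)
  proof (induction "(s, s')" x arbitrary: s s' rule: word_graph.induct)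
    case (gen x)
    then show ?case using that(2) by (rule word_graph.mult)
  next
    case (mult g g' x s s' z)
    have g: "g \<in> carrier S" "g' \<in> carrier S" using mult(1) efa cl by auto
    have "brandt_mult (brandt_mult x z) y = brandt_mult x (brandt_mult z y)"
      by (cases x; cases y; cases z) simp_all
    then show ?case
      using word_graph.mult[OF mult(1) mult(3)] inv[OF mult(2)] inv[OF that(2)] g as by auto
  qed
  have gens: "((e, e), B2_ab) \<in> ?G" "((f, f), B2_ba) \<in> ?G" "((a, ?aa), B2_a) \<in> ?G"
    by (auto intro: word_graph.gen)
  show ?thesis
  proof (rule belongs_to_divisor[OF V finite_semigroup_square[OF S(1)] _ finite_semigroup_Y])
    show "belongs_to (square S) V"
    proof (rule belongs_to_mono_separated[OF V finite_semigroup_square[OF S(1)] S(2)])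
      fix x y :: "'a \<times> 'a" assume "x \<noteq> y"
      moreover have "fst \<in> shom (square S) S" "snd \<in> shom (square S) S"
        by (auto simp: shom_def square_def)
      ultimately show "\<exists>h \<in> shom (square S) S. h x \<noteq> h y" by (metis prod_eqI)
    qed
    show "?G \<subseteq> carrier (square S) \<times> carrier Y_semigroup"
      using inv by (force simp: square_def Y_semigroup_def)
    show "snd ` ?G = carrier Y_semigroup"
    proof
      show "snd ` ?G \<subseteq> carrier Y_semigroup" using inv by (force simp: Y_semigroup_def)
      have "((?aa, ?aa \<cdot>\<^bsub>S\<^esub> ?aa), B2_0) \<in> ?G" using closed[OF gens(3) gens(3)] by simp
      then show "carrier Y_semigroup \<subseteq> snd ` ?G"
        using gens by (force simp: Y_semigroup_def image_iff)
    qed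
    show "(s \<cdot>\<^bsub>square S\<^esub> t, x \<cdot>\<^bsub>Y_semigroup\<^esub> y) \<in> ?G" if "(s, x) \<in> ?G" "(t, y) \<in> ?G" for s t x y
    proof -
      obtain s1 s2 t1 t2 where "s = (s1, s2)" "t = (t1, t2)" by (cases s, cases t)
      then show ?thesis using that closed by (simp add: square_def Y_semigroup_def)
    qed
    fix p x y assume xy: "(p, x) \<in> ?G" "(p, y) \<in> ?G"
    obtain s s' where p: "p = (s, s')" by (cases p)
    \<comment> \<open>A second value over \<open>(e, e)\<close> or \<open>(f, f)\<close> is tested
      by multiplying with the generator over \<open>B2_a\<close>, which leads back to
      \<open>G0\<close>: in \<open>Y\<close> only \<open>B2_ab\<close> fixes \<open>B2_a\<close>
      from the left, and only \<open>B2_ba\<close> from the right.\<close>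
    have "y = x" if x: "((s, s'), x) \<in> ?G" "((s, s'), y) \<in> ?G" "x \<noteq> B2_0" for x y
    proof -
      consider "x = B2_ab" | "x = B2_ba" | "x = B2_a" "s = a" "s' = ?aa" using inv[OF x(1)] x(3) by auto
      then show ?thesis
      proof cases
        case 1
        then have "s = e" "s' = e" using inv[OF x(1)] by auto
        then have "((a, ?aa), brandt_mult y B2_a) \<in> ?G"
          using closed[OF x(2) gens(3)] rel as[of e a a] efa by simp
        from G0[OF this] show ?thesis using 1 by (cases y) auto
      next
        case 2
        then have "s = f" "s' = f" using inv[OF x(1)] by auto
        then have "((a, ?aa), brandt_mult B2_a y) \<in> ?G"
          using closed[OF gens(3) x(2)] rel as[of a a f] efa by simp
        from G0[OF this] show ?thesis using 2 inv[OF x(2)] by (cases y) auto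
      qed (use G0 x in auto)
    qed
    then show "x = y" using xy unfolding p by (cases "x = B2_0"; cases "y = B2_0") metis+
  qed
qed

lemma belongs_to_Y_if_fails_identities:
  fixes S :: "'a semigrp"
  assumes V: "pseudovariety V" and S: "finite_semigroup S" "belongs_to S V"
    and x: "x \<in> carrier S" and ef: "idempotent S e" "idempotent S f"
    and fails: "\<And>i. i \<in> {1, 2, 3} \<Longrightarrow> identity_lhs i S x e f \<noteq> e \<cdot>\<^bsub>S\<^esub> x \<cdot>\<^bsub>S\<^esub> f"
  shows "belongs_to Y_semigroup V"
proof -
  note sS = finite_semigroup_is_semigroup[OF S(1)]
  interpret monoid_mult None "with_one S" by (rule monoid_with_one[OF sS])
  note cl = semigroup_closed[OF sS] and as = semigroup_assoc[OF sS]
  define a where "a = e \<cdot>\<^bsub>S\<^esub> x \<cdot>\<^bsub>S\<^esub> f"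
  have e: "e \<in> carrier S" "e \<cdot>\<^bsub>S\<^esub> e = e" and f: "f \<in> carrier S" "f \<cdot>\<^bsub>S\<^esub> f = f"
    using ef by (auto simp: idempotent_def)
  have a: "a \<in> carrier S" unfolding a_def using cl x e f by blast
  have efc: "e \<cdot>\<^bsub>S\<^esub> f \<in> carrier S" using cl e f by blast
  have ea: "e \<cdot>\<^bsub>S\<^esub> a = a" "a \<cdot>\<^bsub>S\<^esub> f = a"
    unfolding a_def using as[of e e "x \<cdot>\<^bsub>S\<^esub> f"] as[of e x f] as[of "e \<cdot>\<^bsub>S\<^esub> x" f f] e f x cl by simp_all
  have np: "omega S a \<cdot>\<^bsub>S\<^esub> a \<noteq> a" "a \<cdot>\<^bsub>S\<^esub> omega S (e \<cdot>\<^bsub>S\<^esub> f) \<noteq> a" "omega S (e \<cdot>\<^bsub>S\<^esub> f) \<cdot>\<^bsub>S\<^esub> a \<noteq> a"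
    using fails[of 1] fails[of 2] fails[of 3]
    by (simp_all add: identity_lhs_def Let_def omega_plus_1_def a_def)
  have np1: "with_one S (Some a) (power (Some a) (Suc j)) \<noteq> Some a" for j
    using omega_absorbs_left[OF S(1) a a] np(1) power_commutes[of "Some a" "Suc j"] by metis
  have tow: "with_one S (Some p) (Some q) = Some (p \<cdot>\<^bsub>S\<^esub> q)" if "p \<in> carrier S" "q \<in> carrier S" for p q
    using that by simp
  let ?N = "insert None (Some ` carrier S)"
  have N: "finite_submonoid ?N" by (rule finite_submonoid_with_one[OF S(1)])
  have mem: "Some a \<in> ?N" "Some e \<in> ?N" "Some f \<in> ?N" using a e f by auto
  show ?thesis
  proof (cases "\<exists>b \<in> ?N. Some a = with_one S (with_one S (Some a) b) (Some a)")
    case True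
    then obtain b where b: "b \<in> ?N" "Some a = with_one S (with_one S (Some a) b) (Some a)" by blast
    \<comment> \<open>Otherwise \<open>a\<close> would be idempotent and so fixed by a power of
      itself.\<close>
    have "b \<noteq> None"
    proof
      assume "b = None"
      with b(2) np1[of 0] show False by (simp del: with_one.simps(3))
    qed
    then obtain b' where b': "b = Some b'" "b' \<in> carrier S" using b(1) by blast
    obtain M B where "separating (with_one S (Some a) b) (with_one S b (Some a)) (Some a) M B"
      using separating_regular[OF N mem(1) b np1] by blast
    then have "separating (Some (a \<cdot>\<^bsub>S\<^esub> b')) (Some (b' \<cdot>\<^bsub>S\<^esub> a)) (Some a) M B"
      using tow a b' by simp
    then show ?thesis
      using belongs_to_Y_if_separating[OF V S _ _ a] cl a b'(2) by blast
  next
    case False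
    have c: "with_one S (Some e) (Some f) = Some (e \<cdot>\<^bsub>S\<^esub> f)" using tow e f by blast
    obtain M B where "separating (Some e) (Some f) (Some a) M B"
    proof -
      have "\<exists>M B. separating (Some e) (Some f) (Some a) M B"
      proof (rule separating_nonregular[OF N mem])
        show "with_one S (power (with_one S (Some e) (Some f)) (Suc j)) (Some a) \<noteq> Some a" for j
          unfolding c using omega_absorbs_left[OF S(1) efc a] np(3) by blast
        show "with_one S (Some a) (power (with_one S (Some e) (Some f)) (Suc j)) \<noteq> Some a" for j
          unfolding c using omega_absorbs_right[OF S(1) efc a] np(2) by blast
      qed (use tow e f a ea np1 False in auto)
      then show ?thesis using that by blast
    qed
    then show ?thesis by (rule belongs_to_Y_if_separating[OF V S e(1) f(1) a])
  qed
qed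

section \<open>Epimorphic extensions of \<open>Y\<close>\<close>

text \<open>The Brandt semigroup of the monoid \<open>S\<^sup>1\<close> with two indices, \<open>None\<close> being the zero.
  The subsemigroup below consists of zero, the two diagonal identities and the whole upper right
  entry. Inverting its element \<open>(False, 1, True)\<close>, which takes place inside its dominion, yields
  everything.\<close>

definition monoid_carrier :: "'a semigrp \<Rightarrow> 'a option set" where
  "monoid_carrier S = insert None (Some ` carrier S)"

fun brandt_ext_mult :: "'a semigrp \<Rightarrow> (bool \<times> 'a option \<times> bool) option \<Rightarrow>
    (bool \<times> 'a option \<times> bool) option \<Rightarrow> (bool \<times> 'a option \<times> bool) option" where
  "brandt_ext_mult S (Some (i, m, j)) (Some (k, n, l)) =
     (if j = k then Some (i, with_one S m n, l) else None)"
| "brandt_ext_mult S _ _ = None"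

definition brandt_ext :: "'a semigrp \<Rightarrow> (bool \<times> 'a option \<times> bool) option semigrp" where
  "brandt_ext S = \<lparr>carrier = insert None (Some ` (UNIV \<times> monoid_carrier S \<times> UNIV)),
     mult = brandt_ext_mult S\<rparr>"

definition upper_brandt_ext :: "'a semigrp \<Rightarrow> (bool \<times> 'a option \<times> bool) option semigrp" where
  "upper_brandt_ext S = \<lparr>carrier = {None, Some (False, None, False), Some (True, None, True)} \<union>
     (\<lambda>m. Some (False, m, True)) ` monoid_carrier S, mult = brandt_ext_mult S\<rparr>"

lemma monoid_carrier_closed:
  "is_semigroup S \<Longrightarrow> m \<in> monoid_carrier S \<Longrightarrow> n \<in> monoid_carrier S \<Longrightarrow> with_one S m n \<in> monoid_carrier S"
  using semigroup_closed[of S] by (auto simp: monoid_carrier_def)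

lemma brandt_ext_mult_assoc:
  assumes "is_semigroup S"
  shows "brandt_ext_mult S (brandt_ext_mult S x y) z = brandt_ext_mult S x (brandt_ext_mult S y z)"
proof -
  interpret monoid_mult None "with_one S" by (rule monoid_with_one[OF assms])
  show ?thesis
    by (cases x; cases y; cases z) (auto simp: mult.assoc split: if_splits)
qed

lemma finite_semigroup_brandt_ext:
  assumes "finite_semigroup S"
  shows "finite_semigroup (brandt_ext S)"
proof -
  note S = finite_semigroup_is_semigroup[OF assms]
  have "finite (monoid_carrier S)" using assms by (simp add: monoid_carrier_def finite_semigroup_def)
  then show ?thesis
    unfolding finite_semigroup_def is_semigroup_def
    using monoid_carrier_closed[OF S] brandt_ext_mult_assoc[OF S] by (auto simp: brandt_ext_def)
qed

lemma subsemigroup_upper_brandt_ext: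
  assumes "is_semigroup S"
  shows "subsemigroup (upper_brandt_ext S) (brandt_ext S)"
  unfolding subsemigroup_def is_semigroup_def
  using brandt_ext_mult_assoc[OF assms] by (auto simp: upper_brandt_ext_def brandt_ext_def monoid_carrier_def)

lemma belongs_to_upper_brandt_ext:
  assumes V: "pseudovariety V" "belongs_to Y_semigroup V" and S: "finite_semigroup S"
  shows "belongs_to (upper_brandt_ext S) V"
proof (rule belongs_to_mono_separated[OF V(1) _ V(2)])
  let ?U = "upper_brandt_ext S"
  note sub = subsemigroup_upper_brandt_ext[OF finite_semigroup_is_semigroup[OF S]]
  show "finite_semigroup ?U"
    using sub finite_semigroup_brandt_ext[OF S] finite_subset
    unfolding finite_semigroup_def subsemigroup_def by blast
  \<comment> \<open>The upper right entry \<open>m\<close> goes to \<open>B2_a\<close> and all other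
    upper right entries go to zero. Any such collapse is multiplicative, because products of two
    upper right elements vanish and the diagonal identities act trivially.\<close>
  define \<phi> :: "'a option \<Rightarrow> (bool \<times> 'a option \<times> bool) option \<Rightarrow> brandt" where
    "\<phi> m x = (case x of None \<Rightarrow> B2_0 | Some (i, k, j) \<Rightarrow>
      if i then (if j then B2_ba else B2_0) else if j then (if k = m then B2_a else B2_0) else B2_ab)" for m x
  have \<phi>: "\<phi> m \<in> shom ?U Y_semigroup" for m
    by (auto simp: shom_def \<phi>_def upper_brandt_ext_def Y_semigroup_def)
  fix x y assume xy: "x \<in> carrier ?U" "y \<in> carrier ?U" "x \<noteq> y"
  \<comment> \<open>The index \<open>m\<close> is the middle component of one of the two elements;
    \<open>None\<close> is a mere default for the zero.\<close>
  have "\<phi> (case x of Some (i, k, j) \<Rightarrow> k | None \<Rightarrow> None) x \<noteq> \<phi> (case x of Some (i, k, j) \<Rightarrow> k | None \<Rightarrow> None) y \<or>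
    \<phi> (case y of Some (i, k, j) \<Rightarrow> k | None \<Rightarrow> None) x \<noteq> \<phi> (case y of Some (i, k, j) \<Rightarrow> k | None \<Rightarrow> None) y"
    using xy by (auto simp: \<phi>_def upper_brandt_ext_def split: if_splits)
  then show "\<exists>h \<in> shom ?U Y_semigroup. h x \<noteq> h y" using \<phi> by blast
qed

lemma dominion_upper_brandt_ext:
  fixes u :: "'r itself"
  assumes S: "is_semigroup S"
  shows "dominion u (carrier (upper_brandt_ext S)) (brandt_ext S) = carrier (brandt_ext S)"
proof
  let ?T = "brandt_ext S" and ?U = "carrier (upper_brandt_ext S)"
  show "dominion u ?U ?T \<subseteq> carrier ?T" by (auto simp: dominion_def)
  have one: "None \<in> monoid_carrier S" by (simp add: monoid_carrier_def)
  show "carrier ?T \<subseteq> dominion u ?U ?T"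
  proof
    fix d assume d: "d \<in> carrier ?T"
    have "\<beta> d = \<gamma> d" if R: "is_semigroup R" and \<beta>: "\<beta> \<in> shom ?T R" and \<gamma>: "\<gamma> \<in> shom ?T R"
      and eq: "\<forall>x \<in> ?U. \<beta> x = \<gamma> x" for R :: "'r semigrp" and \<beta> \<gamma>
    proof -
      define a where "a m = Some (False, m :: 'a option, True)" for m
      define b where "b = Some (True, None :: 'a option, False)"
      define e where "e i = Some (i, None :: 'a option, i)" for i :: bool
      have T: "a m \<in> carrier ?T" "b \<in> carrier ?T" "e i \<in> carrier ?T" if "m \<in> monoid_carrier S" for m i
        using that one by (auto simp: a_def b_def e_def brandt_ext_def)
      have U: "\<beta> (a m) = \<gamma> (a m)" "\<beta> (e i) = \<gamma> (e i)" if "m \<in> monoid_carrier S" for m i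
        using eq that by (cases i; auto simp: a_def e_def upper_brandt_ext_def)+
      have m: "b \<cdot>\<^bsub>?T\<^esub> e False = b" "a None \<cdot>\<^bsub>?T\<^esub> b = e False" "b \<cdot>\<^bsub>?T\<^esub> a None = e True"
        "e True \<cdot>\<^bsub>?T\<^esub> b = b"
        by (simp_all add: a_def b_def e_def brandt_ext_def)
      note h = shom_mult[OF \<beta>] shom_mult[OF \<gamma>]
      note T1 = T[OF one] and U1 = U[OF one]
      have Rc: "\<beta> x \<in> carrier R" "\<gamma> x \<in> carrier R" if "x \<in> carrier ?T" for x
        using shom_closed[OF \<beta> that] shom_closed[OF \<gamma> that] by simp_all
      \<comment> \<open>Uniqueness of inverses: \<open>b\<close> is inverse to
        \<open>a None\<close>, and both maps agree on \<open>a None\<close> and on the two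
        identities.\<close>
      have "\<beta> b = \<beta> b \<cdot>\<^bsub>R\<^esub> \<beta> (e False)" using h(1)[OF T1(2) T1(3)[of False]] m(1) by simp
      also have "\<dots> = \<beta> b \<cdot>\<^bsub>R\<^esub> (\<beta> (a None) \<cdot>\<^bsub>R\<^esub> \<gamma> b)"
        using h(2)[OF T1(1,2)] m(2) U1(1) U1(2)[of False] by simp
      also have "\<dots> = \<beta> (e True) \<cdot>\<^bsub>R\<^esub> \<gamma> b"
        using h(1)[OF T1(2,1)] m(3) U1(1) semigroup_assoc[OF R Rc(1)[OF T1(2)] Rc(1)[OF T1(1)] Rc(2)[OF T1(2)]]
        by simp
      also have "\<dots> = \<gamma> b" using h(2)[OF T1(3)[of True] T1(2)] m(4) U1(2)[of True] by simp
      finally have b: "\<beta> b = \<gamma> b" .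
      consider "d = None" | m where "m \<in> monoid_carrier S" "d = a m"
        | m where "m \<in> monoid_carrier S" "d = a m \<cdot>\<^bsub>?T\<^esub> b"
        | m where "m \<in> monoid_carrier S" "d = b \<cdot>\<^bsub>?T\<^esub> a m"
        | m where "m \<in> monoid_carrier S" "d = b \<cdot>\<^bsub>?T\<^esub> a m \<cdot>\<^bsub>?T\<^esub> b"
      proof -
        from d consider "d = None" | i m j where "m \<in> monoid_carrier S" "d = Some (i, m, j)"
          unfolding brandt_ext_def by auto
        then show ?thesis
        proof cases
          case (2 i m j)
          then show ?thesis using that(2-5)[of m]
            by (cases i; cases j) (simp_all add: a_def b_def brandt_ext_def)
        qed (use that(1) in simp)
      qed
      then show ?thesis
      proof cases
        case 1
        then show ?thesis using eq by (simp add: upper_brandt_ext_def)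
      next
        case (5 m)
        have "b \<cdot>\<^bsub>?T\<^esub> a m \<in> carrier ?T" using 5 by (simp add: a_def b_def brandt_ext_def)
        then show ?thesis using 5 U(1)[of m] T(1,2)[of m] b by (simp add: h)
      qed (use U(1) T(1) T1(2) b in \<open>simp_all add: h\<close>)
    qed
    then show "d \<in> dominion u ?U ?T" using d unfolding dominion_def by blast
  qed
qed

text \<open>The common source of non-saturation and of the absence of proper closed classes: the
  construction is copied to \<open>nat\<close>, and \<open>S\<close> sits in the diagonal corner
  with both indices \<open>False\<close>.\<close>

lemma epimorphic_extension:
  fixes S :: "nat semigrp" and u :: "'r itself"
  assumes V: "pseudovariety V" "belongs_to Y_semigroup V" and S: "finite_semigroup S"
  obtains U T :: "nat semigrp" and h where "U \<in> V" "finite_semigroup T" "subsemigroup U T"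
    "carrier U \<noteq> carrier T" "dominion u (carrier U) T = carrier T" "h \<in> shom S T" "inj_on h (carrier S)"
proof -
  note sS = finite_semigroup_is_semigroup[OF S]
  let ?T = "brandt_ext S" and ?U = "upper_brandt_ext S"
  note sub = subsemigroup_upper_brandt_ext[OF sS]
  have T: "finite_semigroup ?T" by (rule finite_semigroup_brandt_ext[OF S])
  obtain f :: "(bool \<times> nat option \<times> bool) option \<Rightarrow> nat" where f: "inj_on f (carrier ?T)"
    using finite_semigroup_nat_inj[OF T] .
  define T' where "T' = nat_copy f ?T"
  define U' where "U' = \<lparr>carrier = f ` carrier ?U, mult = mult T'\<rparr>"
  have UT: "carrier ?U \<subseteq> carrier ?T" and sU: "is_semigroup ?U" using sub by (auto simp: subsemigroup_def)
  have fT: "f \<in> shom ?T T'" unfolding T'_def by (rule nat_copy_shom[OF f])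
  then have fU: "f \<in> shom ?U U'" and fUT: "f \<in> shom ?U T'"
    using sub unfolding shom_def U'_def subsemigroup_def by auto
  have cT': "carrier T' = f ` carrier ?T" unfolding T'_def by (rule nat_copy_simps(1)[OF f])
  have sU': "is_semigroup U'" unfolding U'_def by (rule shom_image_semigroup[OF sU fUT])
  have fT': "finite_semigroup T'" unfolding T'_def by (rule nat_copy_semigroup[OF f T])
  have subT': "subsemigroup U' T'"
    using sU' UT cT' by (auto simp: subsemigroup_def U'_def)
  have fU': "finite_semigroup U'"
    using sU' subT' fT' finite_subset unfolding finite_semigroup_def subsemigroup_def by blast
  have "belongs_to U' V"
    by (rule belongs_to_image[OF V(1) belongs_to_upper_brandt_ext[OF V S] fU' fU _ sU])
      (simp add: U'_def)
  then have "U' \<in> V" using belongs_to_iff_mem[OF V(1) fU'] by simp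
  moreover have "carrier U' \<noteq> carrier T'"
  proof -
    have "Some (True, None, False) \<in> carrier ?T - carrier ?U"
      by (auto simp: brandt_ext_def upper_brandt_ext_def monoid_carrier_def)
    then show ?thesis
      using f UT inj_on_image_eq_iff[OF f] unfolding cT' U'_def by auto
  qed
  moreover have "dominion u (carrier U') T' = carrier T'"
  proof
    show "dominion u (carrier U') T' \<subseteq> carrier T'" by (auto simp: dominion_def)
    show "carrier T' \<subseteq> dominion u (carrier U') T'"
    proof
      fix d assume d: "d \<in> carrier T'"
      then obtain d' where d': "d' \<in> carrier ?T" "d = f d'" unfolding cT' by blast
      have "\<beta> d = \<gamma> d" if R: "is_semigroup R" and \<beta>: "\<beta> \<in> shom T' R" and \<gamma>: "\<gamma> \<in> shom T' R"
        and eq: "\<forall>x \<in> carrier U'. \<beta> x = \<gamma> x" for R :: "'r semigrp" and \<beta> \<gamma>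
      proof -
        have "d' \<in> dominion u (carrier ?U) ?T" using dominion_upper_brandt_ext[OF sS, of u] d'(1) by simp
        moreover have "\<forall>x \<in> carrier ?U. (\<beta> \<circ> f) x = (\<gamma> \<circ> f) x" using eq by (simp add: U'_def)
        ultimately have "(\<beta> \<circ> f) d' = (\<gamma> \<circ> f) d'"
          using R shom_comp[OF fT \<beta>] shom_comp[OF fT \<gamma>] unfolding dominion_def by blast
        then show ?thesis using d'(2) by simp
      qed
      then show "d \<in> dominion u (carrier U') T'" using d unfolding dominion_def by blast
    qed
  qed
  moreover define h where "h = f \<circ> (\<lambda>s. Some (False, Some s, False))"
  have g: "(\<lambda>s. Some (False, Some s, False)) \<in> shom S ?T"
    by (auto simp: shom_def brandt_ext_def monoid_carrier_def)
  then have "h \<in> shom S T'" unfolding h_def using shom_comp fT by blast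
  moreover have "inj_on h (carrier S)"
    unfolding h_def using f shom_closed[OF g] by (auto simp: inj_on_def)
  ultimately show ?thesis using that fT' subT' by blast
qed

lemma not_F_saturated_if_Y:
  assumes V: "pseudovariety V" "belongs_to Y_semigroup V"
  shows "\<not> F_saturated u V"
proof -
  obtain S where "S \<in> V" using V(2) by (auto simp: belongs_to_def)
  then have "finite_semigroup S" by (rule pseudovariety_finite[OF V(1)])
  from epimorphic_extension[OF V this] obtain U T :: "nat semigrp" where
    "U \<in> V" "finite_semigroup T" "subsemigroup U T" "carrier U \<noteq> carrier T"
    "dominion u (carrier U) T = carrier T" by metis
  then show ?thesis unfolding F_saturated_def F_saturated_semigroup_def by blast
qed

text \<open>The inclusion of a dominating subsemigroup is an epimorphism, so \<open>W\<close>
  contains the extension and thereby the copy of an arbitrary \<open>S\<close> inside it.\<close>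

lemma F_epi_closed_with_Y:
  assumes W: "pseudovariety W" "F_epi_closed u W" "belongs_to Y_semigroup W"
  shows "W = finite_semigroups"
proof
  show "W \<subseteq> finite_semigroups" using W(1) by (simp add: pseudovariety_def)
  show "finite_semigroups \<subseteq> W"
  proof
    fix S assume "S \<in> finite_semigroups"
    then have S: "finite_semigroup S" by (simp add: finite_semigroups_def)
    from epimorphic_extension[OF W(1,3) this] obtain U T :: "nat semigrp" and h where
      UT: "U \<in> W" "finite_semigroup T" "subsemigroup U T"
      "dominion u (carrier U) T = carrier T" "h \<in> shom S T" "inj_on h (carrier S)" by metis
    have "epimorphism u U T id"
      using UT(3,4) by (auto simp: epimorphism_iff_dominion shom_def subsemigroup_def)
    then have "T \<in> W" using W(2) UT(1,2) unfolding F_epi_closed_def by blast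
    then have "belongs_to T W" using belongs_to_iff_mem[OF W(1) UT(2)] by simp
    then have "belongs_to S W"
      by (rule belongs_to_mono_separated[OF W(1) S]) (use UT(5,6) in \<open>auto simp: inj_on_def\<close>)
    then show "S \<in> W" using belongs_to_iff_mem[OF W(1) S] by simp
  qed
qed

text \<open>Separate witnesses against the three identities are combined into one element of a
  product, which then fails all three at once.\<close>

lemma subset_V_if_not_Y:
  assumes V: "pseudovariety V" and Y: "\<not> belongs_to Y_semigroup V"
  shows "V \<subseteq> V1 \<or> V \<subseteq> V2 \<or> V \<subseteq> V3"
proof (rule ccontr)
  assume "\<not> (V \<subseteq> V1 \<or> V \<subseteq> V2 \<or> V \<subseteq> V3)"
  \<comment> \<open>The factors are numbered from 0 and the identities from 1, hence the
    \<open>Suc\<close>.\<close>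
  then have "\<exists>S \<in> V. \<not> satisfies (Suc j) S" if "j < 3" for j
    using that pseudovariety_finite[OF V] unfolding V_satisfies
    by (auto simp: less_Suc_eq numeral_eq_Suc subset_iff)
  then have "\<forall>j. \<exists>q. j < 3 \<longrightarrow> (case q of (S, x, e, f) \<Rightarrow> S \<in> V \<and> x \<in> carrier S \<and> idempotent S e \<and>
      idempotent S f \<and> identity_lhs (Suc j) S x e f \<noteq> e \<cdot>\<^bsub>S\<^esub> x \<cdot>\<^bsub>S\<^esub> f)"
    unfolding satisfies_def by fastforce
  from choice[OF this] obtain q where q: "\<And>j. j < 3 \<Longrightarrow> (case q j of (S, x, e, f) \<Rightarrow> S \<in> V \<and>
      x \<in> carrier S \<and> idempotent S e \<and> idempotent S f \<and> identity_lhs (Suc j) S x e f \<noteq> e \<cdot>\<^bsub>S\<^esub> x \<cdot>\<^bsub>S\<^esub> f)"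
    by blast
  define F where "F j = fst (q j)" for j
  define x where "x = (\<lambda>j \<in> {..<3}. fst (snd (q j)))"
  define e where "e = (\<lambda>j \<in> {..<3}. fst (snd (snd (q j))))"
  define f where "f = (\<lambda>j \<in> {..<3}. snd (snd (snd (q j))))"
  have Fq: "F j \<in> V" "x j \<in> carrier (F j)" "idempotent (F j) (e j)" "idempotent (F j) (f j)"
    "identity_lhs (Suc j) (F j) (x j) (e j) (f j) \<noteq> e j \<cdot>\<^bsub>F j\<^esub> x j \<cdot>\<^bsub>F j\<^esub> f j" if "j < 3" for j
    using q[OF that] that unfolding F_def x_def e_def f_def by (auto simp: case_prod_beta)
  let ?P = "product_semigroup {..<3} F"
  have P: "finite_semigroup ?P"
    by (rule finite_product_semigroup) (use Fq(1) pseudovariety_finite[OF V] in auto)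
  note sP = finite_semigroup_is_semigroup[OF P]
  have "e \<in> extensional {..<3}" "f \<in> extensional {..<3}" "x \<in> extensional {..<3}"
    unfolding e_def f_def x_def by simp_all
  then have efx: "x \<in> carrier ?P" "e \<in> carrier ?P" "f \<in> carrier ?P"
    using Fq by (auto simp: product_semigroup_def PiE_def idempotent_def)
  have idem: "idempotent ?P e" "idempotent ?P f"
    using efx(2,3) Fq(3,4) \<open>e \<in> extensional {..<3}\<close> \<open>f \<in> extensional {..<3}\<close>
    by (auto simp: idempotent_def product_semigroup_def fun_eq_iff extensional_def)
  have "belongs_to Y_semigroup V"
  proof (rule belongs_to_Y_if_fails_identities[OF V P _ efx(1) idem])
    show "belongs_to ?P V" by (rule pseudovariety_product[OF V]) (use Fq(1) in simp)
    fix i :: nat assume "i \<in> {1, 2, 3}"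
    then obtain j where j: "i = Suc j" "j < 3" by auto
    have h: "(\<lambda>x. x j) \<in> shom ?P (F j)" using product_semigroup_proj[of j "{..<3}" F] j by simp
    have sF: "is_semigroup (F j)"
      using Fq(1) j pseudovariety_finite[OF V] finite_semigroup_is_semigroup by blast
    show "identity_lhs i ?P x e f \<noteq> e \<cdot>\<^bsub>?P\<^esub> x \<cdot>\<^bsub>?P\<^esub> f"
    proof
      assume "identity_lhs i ?P x e f = e \<cdot>\<^bsub>?P\<^esub> x \<cdot>\<^bsub>?P\<^esub> f"
      then have "identity_lhs i (F j) (x j) (e j) (f j) = e j \<cdot>\<^bsub>F j\<^esub> x j \<cdot>\<^bsub>F j\<^esub> f j"
        using identity_lhs_shom[OF P sF h efx, of i] efx semigroup_closed[OF sP]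
        by (simp add: shom_mult[OF h])
      then show False using Fq(5)[OF j(2)] j(1) by simp
    qed
  qed
  then show False using Y by simp
qed

section \<open>The decision procedure\<close>

definition comp_comb :: "comb \<Rightarrow> comb \<Rightarrow> comb" where
  "comp_comb f g = S_comb \<bullet> (K_comb \<bullet> f) \<bullet> g"

text \<open>Composition as a closed combinator, for use where the composed terms arise only during
  reduction.\<close>

definition B_comb :: comb where
  "B_comb = S_comb \<bullet> (K_comb \<bullet> S_comb) \<bullet> K_comb"

definition dup_comb :: comb where
  "dup_comb = S_comb \<bullet> I_comb \<bullet> I_comb"

text \<open>\<open>apply_comb h\<close> is \<open>\<lambda>t u. h t (h u)\<close> and \<open>branch_comb h\<close> is \<open>\<lambda>x. x S K h\<close>.\<close>

definition apply_comb :: "comb \<Rightarrow> comb" where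
  "apply_comb h = S_comb \<bullet> (B_comb \<bullet> B_comb \<bullet> h) \<bullet> (K_comb \<bullet> h)"

definition branch_comb :: "comb \<Rightarrow> comb" where
  "branch_comb h =
     S_comb \<bullet> (S_comb \<bullet> (S_comb \<bullet> I_comb \<bullet> (K_comb \<bullet> S_comb)) \<bullet> (K_comb \<bullet> K_comb)) \<bullet> (K_comb \<bullet> h)"

text \<open>\<open>interp_step\<close> is \<open>\<lambda>g. branch_comb (apply_comb (g g))\<close>, with the abstraction over \<open>g\<close>
  eliminated. Its self-application is a fixed point that interprets encoded terms.\<close>

definition interp_step :: comb where
  "interp_step = comp_comb
     (S_comb \<bullet> (S_comb \<bullet> (S_comb \<bullet> I_comb \<bullet> (K_comb \<bullet> S_comb)) \<bullet> (K_comb \<bullet> K_comb)))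
     (comp_comb K_comb (S_comb \<bullet> comp_comb S_comb (comp_comb (B_comb \<bullet> B_comb) dup_comb) \<bullet>
        comp_comb K_comb dup_comb))"

definition interp :: comb where
  "interp = interp_step \<bullet> interp_step"

lemma reduces_comp: "comp_comb f g \<bullet> x \<rightarrow>\<^sub>w f \<bullet> (g \<bullet> x)"
  unfolding comp_comb_def by (meson reduces_S reduces_K reduces_app rtranclp_trans)

lemma reduces_B: "B_comb \<bullet> f \<bullet> g \<bullet> x \<rightarrow>\<^sub>w f \<bullet> (g \<bullet> x)"
proof -
  have "B_comb \<bullet> f \<rightarrow>\<^sub>w S_comb \<bullet> (K_comb \<bullet> f)"
    unfolding B_comb_def by (meson reduces_S reduces_K reduces_app rtranclp_trans)
  then have "B_comb \<bullet> f \<bullet> g \<bullet> x \<rightarrow>\<^sub>w comp_comb f g \<bullet> x"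
    unfolding comp_comb_def by (intro reduces_app)
  then show ?thesis using reduces_comp rtranclp_trans by metis
qed

lemma reduces_dup: "dup_comb \<bullet> x \<rightarrow>\<^sub>w x \<bullet> x"
  unfolding dup_comb_def by (meson reduces_S reduces_I reduces_app reduces_app2 rtranclp_trans)

lemma reduces_apply: "apply_comb h \<bullet> t \<bullet> u \<rightarrow>\<^sub>w h \<bullet> t \<bullet> (h \<bullet> u)"
proof -
  have "apply_comb h \<bullet> t \<rightarrow>\<^sub>w B_comb \<bullet> B_comb \<bullet> h \<bullet> t \<bullet> (K_comb \<bullet> h \<bullet> t)"
    unfolding apply_comb_def by (rule reduces_S)
  also have "\<dots> \<rightarrow>\<^sub>w B_comb \<bullet> (h \<bullet> t) \<bullet> (K_comb \<bullet> h \<bullet> t)" by (intro reduces_app reduces_B)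
  also have "\<dots> \<rightarrow>\<^sub>w B_comb \<bullet> (h \<bullet> t) \<bullet> h" by (intro reduces_app2 reduces_K)
  finally have "apply_comb h \<bullet> t \<bullet> u \<rightarrow>\<^sub>w B_comb \<bullet> (h \<bullet> t) \<bullet> h \<bullet> u" by (rule reduces_app)
  then show ?thesis using reduces_B rtranclp_trans by metis
qed

lemma reduces_branch: "branch_comb h \<bullet> x \<rightarrow>\<^sub>w x \<bullet> S_comb \<bullet> K_comb \<bullet> h"
proof -
  let ?A = "S_comb \<bullet> I_comb \<bullet> (K_comb \<bullet> S_comb)"
  have "?A \<bullet> x \<rightarrow>\<^sub>w x \<bullet> S_comb"
    by (meson reduces_S reduces_I reduces_K reduces_app reduces_app2 rtranclp_trans)
  then have "S_comb \<bullet> ?A \<bullet> (K_comb \<bullet> K_comb) \<bullet> x \<rightarrow>\<^sub>w x \<bullet> S_comb \<bullet> K_comb"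
    by (meson reduces_S reduces_K reduces_app reduces_app2 rtranclp_trans)
  then show ?thesis
    unfolding branch_comb_def by (meson reduces_S reduces_K reduces_app reduces_app2 rtranclp_trans)
qed

lemma reduces_interp_step: "interp_step \<bullet> g \<rightarrow>\<^sub>w branch_comb (apply_comb (g \<bullet> g))"
proof -
  let ?F = "S_comb \<bullet> comp_comb S_comb (comp_comb (B_comb \<bullet> B_comb) dup_comb) \<bullet>
    comp_comb K_comb dup_comb"
  have "comp_comb (B_comb \<bullet> B_comb) dup_comb \<bullet> g \<rightarrow>\<^sub>w B_comb \<bullet> B_comb \<bullet> (g \<bullet> g)"
    by (meson reduces_comp reduces_dup reduces_app2 rtranclp_trans)
  then have 1: "comp_comb S_comb (comp_comb (B_comb \<bullet> B_comb) dup_comb) \<bullet> g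
      \<rightarrow>\<^sub>w S_comb \<bullet> (B_comb \<bullet> B_comb \<bullet> (g \<bullet> g))"
    by (meson reduces_comp reduces_app2 rtranclp_trans)
  have 2: "comp_comb K_comb dup_comb \<bullet> g \<rightarrow>\<^sub>w K_comb \<bullet> (g \<bullet> g)"
    by (meson reduces_comp reduces_dup reduces_app2 rtranclp_trans)
  have "?F \<bullet> g \<rightarrow>\<^sub>w apply_comb (g \<bullet> g)"
    unfolding apply_comb_def using 1 2 by (meson reduces_S reduces_app reduces_app2 rtranclp_trans)
  then have "comp_comb K_comb ?F \<bullet> g \<rightarrow>\<^sub>w K_comb \<bullet> apply_comb (g \<bullet> g)"
    by (meson reduces_comp reduces_app2 rtranclp_trans)
  then show ?thesis
    unfolding interp_step_def branch_comb_def by (meson reduces_comp reduces_app2 rtranclp_trans)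
qed

lemma reduces_interp: "interp \<bullet> x \<rightarrow>\<^sub>w x \<bullet> S_comb \<bullet> K_comb \<bullet> apply_comb interp"
proof -
  have "interp \<bullet> x \<rightarrow>\<^sub>w branch_comb (apply_comb interp) \<bullet> x"
    using reduces_app[OF reduces_interp_step, of interp_step x] unfolding interp_def .
  then show ?thesis using reduces_branch rtranclp_trans by metis
qed

text \<open>The decision procedure is handed the code of an algorithm; the interpreter turns the
  code back into a running term.\<close>

lemma interp_encode: "interp \<bullet> encode_comb t \<rightarrow>\<^sub>w t"
proof (induction t)
  case S_comb
  show ?case using reduces_interp encode_comb_case(1) rtranclp_trans by metis
next
  case K_comb
  show ?case using reduces_interp encode_comb_case(2) rtranclp_trans by metis
next
  case (Ap t u)
  have "interp \<bullet> encode_comb (t \<bullet> u) \<rightarrow>\<^sub>w encode_comb (t \<bullet> u) \<bullet> S_comb \<bullet> K_comb \<bullet> apply_comb interp"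
    by (rule reduces_interp)
  also have "\<dots> \<rightarrow>\<^sub>w apply_comb interp \<bullet> encode_comb t \<bullet> encode_comb u" by (rule encode_comb_case(3))
  also have "\<dots> \<rightarrow>\<^sub>w interp \<bullet> encode_comb t \<bullet> (interp \<bullet> encode_comb u)" by (rule reduces_apply)
  also have "\<dots> \<rightarrow>\<^sub>w t \<bullet> (interp \<bullet> encode_comb u)" using Ap(1) by (rule reduces_app)
  also have "\<dots> \<rightarrow>\<^sub>w t \<bullet> u" using Ap(2) by (rule reduces_app2)
  finally show ?case .
qed

lemma reduces_not: "encode_bool b \<bullet> false_comb \<bullet> true_comb \<rightarrow>\<^sub>w encode_bool (\<not> b)"
proof (cases b)
  case True
  then show ?thesis using reduces_K by (simp add: encode_bool_def true_comb_def)
next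
  case False
  have "false_comb \<bullet> false_comb \<bullet> true_comb \<rightarrow>\<^sub>w I_comb \<bullet> true_comb"
    unfolding false_comb_def by (intro reduces_app reduces_K)
  also have "\<dots> \<rightarrow>\<^sub>w true_comb" by (rule reduces_I)
  finally show ?thesis using False by (simp add: encode_bool_def)
qed

text \<open>This is \<open>\<lambda>x. interp x y false true\<close> with the abstraction
  eliminated: the encoded algorithm \<open>x\<close> is run on \<open>y\<close>, and the last two
  arguments negate its answer.\<close>

definition decider :: "comb \<Rightarrow> comb" where
  "decider y = S_comb \<bullet> (S_comb \<bullet> (S_comb \<bullet> interp \<bullet> (K_comb \<bullet> y)) \<bullet> (K_comb \<bullet> false_comb)) \<bullet>
     (K_comb \<bullet> true_comb)"

lemma reduces_decider:
  "decider y \<bullet> x \<rightarrow>\<^sub>w interp \<bullet> x \<bullet> y \<bullet> false_comb \<bullet> true_comb"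
proof -
  have flip: "S_comb \<bullet> f \<bullet> (K_comb \<bullet> c) \<bullet> x \<rightarrow>\<^sub>w g \<bullet> c" if "f \<bullet> x \<rightarrow>\<^sub>w g" for f c g
    using that by (meson reduces_S reduces_K reduces_app reduces_app2 rtranclp_trans)
  show ?thesis unfolding decider_def by (intro flip) simp
qed

lemma decider_decides:
  assumes V: "decides_membership p V" and Y: "finite_semigroup Y" "carrier Y = {..<n}"
  shows "decider (encode_semigroup Y) \<bullet> encode_comb p \<rightarrow>\<^sub>w encode_bool (Y \<notin> V)"
proof -
  let ?y = "encode_semigroup Y"
  have "decider ?y \<bullet> encode_comb p \<rightarrow>\<^sub>w interp \<bullet> encode_comb p \<bullet> ?y \<bullet> false_comb \<bullet> true_comb"
    by (rule reduces_decider)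
  also have "\<dots> \<rightarrow>\<^sub>w p \<bullet> ?y \<bullet> false_comb \<bullet> true_comb" by (intro reduces_app interp_encode)
  also have "\<dots> \<rightarrow>\<^sub>w encode_bool (Y \<in> V) \<bullet> false_comb \<bullet> true_comb"
    using V Y unfolding decides_membership_def by (intro reduces_app) blast
  also have "\<dots> \<rightarrow>\<^sub>w encode_bool (Y \<notin> V)" by (rule reduces_not)
  finally show ?thesis .
qed

text \<open>A deciding term is constrained only on carriers of the form \<open>{..<n}\<close>, so
  \<open>Y\<close> has to be renumbered in this way, by one copy that serves all
  \<open>V\<close>.\<close>

lemma standard_nat_copy:
  assumes S: "finite_semigroup S"
  obtains T :: "nat semigrp" and n where "finite_semigroup T" "carrier T = {..<n}"
    "\<And>V. pseudovariety V \<Longrightarrow> belongs_to S V \<longleftrightarrow> T \<in> V"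
proof -
  obtain f where f: "bij_betw f (carrier S) {0..<card (carrier S)}"
    using S ex_bij_betw_finite_nat unfolding finite_semigroup_def by blast
  then have inj: "inj_on f (carrier S)" by (simp add: bij_betw_def)
  let ?T = "nat_copy f S"
  have T: "finite_semigroup ?T" by (rule nat_copy_semigroup[OF inj S])
  moreover have "carrier ?T = {..<card (carrier S)}"
    using f by (simp add: nat_copy_simps(1)[OF inj] bij_betw_def atLeast0LessThan)
  moreover have "belongs_to S V \<longleftrightarrow> ?T \<in> V" if V: "pseudovariety V" for V
  proof
    assume "belongs_to S V"
    then have "belongs_to ?T V"
      using belongs_to_image[OF V _ T nat_copy_shom[OF inj]] nat_copy_simps(1)[OF inj]
        finite_semigroup_is_semigroup[OF S] by simp
    then show "?T \<in> V" using belongs_to_iff_mem[OF V T] by simp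
  next
    assume "?T \<in> V"
    then show "belongs_to S V"
      unfolding belongs_to_def isomorphic_def
      using nat_copy_shom[OF inj] inj nat_copy_simps(1)[OF inj] by (metis bij_betw_def)
  qed
  ultimately show ?thesis using that by blast
qed

theorem theorem5p5:
  fixes u :: "'r itself"
  assumes "infinite (UNIV :: 'r set)"
  shows
    "pseudovariety V1 \<and> pseudovariety V2 \<and> pseudovariety V3 \<and>
     (\<forall>V. pseudovariety V \<longrightarrow>
        (alternative_1 u V \<or> alternative_2 u V) \<and> \<not> (alternative_1 u V \<and> alternative_2 u V) \<and>
        (alternative_2 u V \<longleftrightarrow> belongs_to Y_semigroup V) \<and>
        (V \<noteq> finite_semigroups \<longrightarrow> (F_epi_closed u V \<longleftrightarrow> F_saturated u V))) \<and>
     (\<exists>D. \<forall>V p. pseudovariety V \<and> decides_membership p V \<longrightarrow>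
        D \<bullet> encode_comb p \<rightarrow>\<^sub>w encode_bool (F_saturated u V))"
proof -
  \<comment> \<open>Everything depends on whether \<open>Y\<close> belongs to \<open>V\<close>. The
    facts \<open>no\<close> and \<open>yes\<close> treat the two cases, and the claims about closure
    and saturation follow from them propositionally.\<close>
  have no: "alternative_1 u V" if "pseudovariety V" "\<not> belongs_to Y_semigroup V" for V
    using subset_V_if_not_Y[OF that] F_saturated_if_subset[OF assms, of V u]
      F_epi_closed_if_F_saturated[OF that(1), of u]
    unfolding alternative_1_def by blast
  have yes: "alternative_2 u V" if V: "pseudovariety V" "belongs_to Y_semigroup V" for V
  proof -
    have "W = finite_semigroups" if "pseudovariety W" "F_epi_closed u W" "V \<subseteq> W" for W
      by (rule F_epi_closed_with_Y[OF that(1,2)]) (use V(2) that(3) in \<open>auto simp: belongs_to_def\<close>)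
    then show ?thesis unfolding alternative_2_def using not_F_saturated_if_Y[OF V] by blast
  qed
  have excl: "\<not> (alternative_1 u V \<and> alternative_2 u V)" for V
    by (simp add: alternative_1_def alternative_2_def)
  have epi: "F_epi_closed u V \<longleftrightarrow> F_saturated u V"
    if "pseudovariety V" "V \<noteq> finite_semigroups" for V
    using no[OF that(1)] yes[OF that(1)] that unfolding alternative_1_def alternative_2_def by blast
  have sat: "F_saturated u V \<longleftrightarrow> \<not> belongs_to Y_semigroup V" if "pseudovariety V" for V
    using no[OF that] yes[OF that] unfolding alternative_1_def alternative_2_def by blast
  obtain Y :: "nat semigrp" and n where Y: "finite_semigroup Y" "carrier Y = {..<n}"
    "\<And>V. pseudovariety V \<Longrightarrow> belongs_to Y_semigroup V \<longleftrightarrow> Y \<in> V"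
    using standard_nat_copy[OF finite_semigroup_Y] by blast
  \<comment> \<open>The term has the table of \<open>Y\<close> built in and depends neither on
    \<open>V\<close> nor on \<open>p\<close>.\<close>
  have "\<forall>V p. pseudovariety V \<and> decides_membership p V \<longrightarrow>
      decider (encode_semigroup Y) \<bullet> encode_comb p \<rightarrow>\<^sub>w encode_bool (F_saturated u V)"
    using decider_decides[OF _ Y(1,2)] sat Y(3) by simp
  moreover have "pseudovariety V1" "pseudovariety V2" "pseudovariety V3"
    unfolding V_satisfies by (rule pseudovariety_satisfies)+
  ultimately show ?thesis using no yes excl epi by blast
qed

end
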